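(* Let $n\ge 1$ and $p\in[1,\infty]$. For every function $f\in L^p(\mathbb{R}^n)$ and every $\varepsilon>0$, $$ 2^{-1}\omega_p(f, 2\varepsilon)\le \widetilde{\sigma}_p(f, \varepsilon)\le \sigma_p(f, \varepsilon)\le 2(1+\sqrt{n}+n)\,\omega_p(f, \varepsilon). $$
   Context: Functions are real-valued; $L^p$-norms $\|\cdot\|_p$ are with respect to Lebesgue measure on $\mathbb{R}^n$, $|\cdot|$ is the Euclidean norm, and $q=p/(p-1)$ is the dual exponent, $1/p+1/q=1$ (so $q=\infty$ if $p=1$ and $q=1$ if $p=\infty$). $C_0^\infty$ denotes infinitely differentiable compactly supported functions (or vector fields); for a vector field $\Phi$, $\|\Phi\|_q$ is the $L^q$-norm of $|\Phi|$. With $f_h(x):=f(x-h)$, define for $f\in L^p(\mathbb{R}^n)$ and $\varepsilon>0$: $$\omega_p(f,\varepsilon):=\sup_{|h|\le\varepsilon}\|f_h-f\|_p,$$ $$\sigma_p(f,\varepsilon):=\sup\Bigl\{\int_{\mathbb{R}^n}\mathrm{div}\,\Phi(x) f(x)\,dx:\ \Phi\in C_0^\infty(\mathbb{R}^n,\mathbb{R}^n),\ \|\mathrm{div}\,\Phi\|_q\le 1,\ \|\Phi\|_q\le\varepsilon\Bigr\},$$ $$\widetilde\sigma_p(f,\varepsilon):=\sup\Bigl\{\int_{\mathbb{R}^n}\partial_e\varphi(x) f(x)\,dx:\ e\in\mathbb{R}^n,\ |e|=1,\ \varphi\in C_0^\infty(\mathbb{R}^n),\ \|\partial_e\varphi\|_q\le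 1,\ \|\varphi\|_q\le\varepsilon\Bigr\},$$ where $\partial_e$ is the derivative in direction $e$. *)

theory Defs
  imports "HOL-Analysis.Analysis" "HOL-Probability.Essential_Supremum"
begin

text \<open>Exponents range over \<open>[1, \<infinity>]\<close> inside \<^typ>\<open>ereal\<close>; norms and moduli take
  values in \<^typ>\<open>ereal\<close>, so that all suprema are suprema in a complete lattice.
  Elements of \<open>L\<^sup>p\<close> are Lebesgue measurable functions, not equivalence classes.\<close>

definition dual_exponent :: "ereal \<Rightarrow> ereal" where
  "dual_exponent p = (if p = 1 then \<infinity> else if p = \<infinity> then 1 else p / (p - 1))"

text \<open>For vector-valued \<open>f\<close> this is the \<open>L\<^sup>p\<close>-norm of the pointwise norm of \<open>f\<close>.\<close>

definition Lp_norm :: "ereal \<Rightarrow> ('a::euclidean_space \<Rightarrow> 'b::real_normed_vector) \<Rightarrow> ereal" where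
  "Lp_norm p f =
    (if p = \<infinity> then esssup lebesgue (\<lambda>x. ereal (norm (f x)))
     else let I = (\<integral>\<^sup>+ x. ennreal (norm (f x) powr real_of_ereal p) \<partial>lebesgue)
          in if I = \<infinity> then \<infinity> else ereal (enn2real I powr (1 / real_of_ereal p)))"

definition Lp_space :: "ereal \<Rightarrow> ('a::euclidean_space \<Rightarrow> real) set" where
  "Lp_space p = {f \<in> borel_measurable lebesgue. Lp_norm p f < \<infinity>}"

primrec k_times_cont_differentiable ::
    "nat \<Rightarrow> ('a::euclidean_space \<Rightarrow> 'b::real_normed_vector) \<Rightarrow> bool" where
  "k_times_cont_differentiable 0 f \<longleftrightarrow> continuous_on UNIV f"
| "k_times_cont_differentiable (Suc k) f \<longleftrightarrow>
     (\<forall>x. f differentiable (at x)) \<and>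
     (\<forall>v. k_times_cont_differentiable k (\<lambda>x. frechet_derivative f (at x) v))"

definition C0_infinity :: "('a::euclidean_space \<Rightarrow> 'b::real_normed_vector) set" where
  "C0_infinity =
    {f. (\<forall>k. k_times_cont_differentiable k f) \<and> compact (closure (support_on UNIV f))}"

definition directional_derivative ::
    "real ^ 'n \<Rightarrow> (real ^ 'n \<Rightarrow> real) \<Rightarrow> real ^ 'n \<Rightarrow> real" where
  "directional_derivative e \<phi> x = deriv (\<lambda>t. \<phi> (x + t *\<^sub>R e)) 0"

definition divergence :: "(real ^ 'n \<Rightarrow> real ^ 'n) \<Rightarrow> real ^ 'n \<Rightarrow> real" where
  "divergence \<Phi> x =
    (\<Sum>i\<in>UNIV. directional_derivative (axis i 1) (\<lambda>y. \<Phi> y $ i) x)"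

definition omega_modulus :: "ereal \<Rightarrow> (real ^ 'n \<Rightarrow> real) \<Rightarrow> real \<Rightarrow> ereal" where
  "omega_modulus p f \<epsilon> = (SUP h\<in>{h. norm h \<le> \<epsilon>}. Lp_norm p (\<lambda>x. f (x - h) - f x))"

definition sigma_modulus :: "ereal \<Rightarrow> (real ^ 'n \<Rightarrow> real) \<Rightarrow> real \<Rightarrow> ereal" where
  "sigma_modulus p f \<epsilon> = Sup {ereal (LINT x|lebesgue. divergence \<Phi> x * f x) | \<Phi>.
     \<Phi> \<in> C0_infinity \<and>
     Lp_norm (dual_exponent p) (divergence \<Phi>) \<le> 1 \<and>
     Lp_norm (dual_exponent p) \<Phi> \<le> ereal \<epsilon>}"

definition sigma_tilde_modulus :: "ereal \<Rightarrow> (real ^ 'n \<Rightarrow> real) \<Rightarrow> real \<Rightarrow> ereal" where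
  "sigma_tilde_modulus p f \<epsilon> = Sup {ereal (LINT x|lebesgue. directional_derivative e \<phi> x * f x) | e \<phi>.
     norm e = 1 \<and> \<phi> \<in> C0_infinity \<and>
     Lp_norm (dual_exponent p) (directional_derivative e \<phi>) \<le> 1 \<and>
     Lp_norm (dual_exponent p) \<phi> \<le> ereal \<epsilon>}"

end

theory Submission
  imports Defs "HOL-Probability.Probability_Measure"
begin

text \<open>The integrals defining the moduli \<open>\<sigma>\<close> and \<open>\<sigma>~\<close> see \<open>f\<close> only through its pairing with continuous
compactly supported functions, so every smoothing takes place on the test functions, and \<open>f\<close> may be
replaced by a locally integrable Borel function that equals it almost everywhere. The tool is the
average \<open>A\<^sub>v g (x)\<close> of \<open>g\<close> over the segment from \<open>x\<close> to \<open>x + v\<close>. It preserves smoothness and does not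
increase \<open>L\<^sup>q\<close>-norms, and by the fundamental theorem of calculus \<open>A\<^sub>v (\<partial>\<^sub>v g) (x) = g(x + v) - g(x)\<close>.

\<^emph>\<open>Lower bound\<close> (\<open>Lp_norm_difference_le_by_directional_derivatives\<close>). By duality
(\<open>Lp_norm_le_by_duality\<close>), the norm of \<open>f(x - h) - f(x)\<close> is the supremum of its pairings with smooth \<open>g\<close> of dual norm at most \<open>1\<close>, that is,
of the pairings of \<open>f\<close> with \<open>g(x + h) - g(x)\<close>. For \<open>h = t e\<close> with \<open>|e| = 1\<close> and \<open>0 \<le> t \<le> 2 \<epsilon>\<close>, half of
this difference is \<open>\<partial>\<^sub>e \<phi>\<close> with \<open>\<phi> = (t/2) A\<^sub>h g\<close>, and \<open>(e, \<phi>)\<close> is admissible for \<open>\<sigma>~\<close>.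

\<^emph>\<open>Middle inequality\<close> (\<open>sigma_tilde_modulus_le_sigma_modulus\<close>). The field \<open>\<phi> e\<close> has divergence \<open>\<partial>\<^sub>e \<phi>\<close>.

\<^emph>\<open>Upper bound\<close> (\<open>divergence_pairing_le\<close>). Let \<open>A\<close> be the composition of the averages along the vectors
\<open>\<epsilon> e\<^sub>i\<close>. Replacing \<open>div \<Phi>\<close> by \<open>A (div \<Phi>)\<close> in the pairing with \<open>f\<close> costs at most \<open>n\<close> times the modulus
\<open>\<omega>(f, \<epsilon>)\<close>, one summand per coordinate (\<open>iterated_average_telescope\<close>), because each step compares a
function with translates of itself by at most \<open>\<epsilon>\<close> and the translation can be moved onto \<open>f\<close>. The
averages commute, so \<open>A (\<partial>\<^sub>i \<Phi>\<^sub>i)\<close> is a difference quotient with step \<open>\<epsilon>\<close> of an average of \<open>\<Phi>\<^sub>i\<close>, and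
its pairing with \<open>f\<close> is at most \<open>(1/\<epsilon>) \<epsilon> \<omega>(f, \<epsilon>)\<close>. Altogether this gives
\<open>\<sigma>(f, \<epsilon>) \<le> 2 n \<omega>(f, \<epsilon>)\<close>, which implies the stated bound.\<close>

section \<open>Smooth functions\<close>

text \<open>\<open>C\<^sup>\<infinity>\<close> without any condition on the support.\<close>

definition smooth_fun :: "('a::euclidean_space \<Rightarrow> 'b::real_normed_vector) \<Rightarrow> bool" where
  "smooth_fun f \<longleftrightarrow> (\<forall>k. k_times_cont_differentiable k f)"

lemma k_times_cont_differentiable_SucI:
  assumes "\<And>x. (f has_derivative f' x) (at x)"
    and "\<And>v. k_times_cont_differentiable k (\<lambda>x. f' x v)"
  shows "k_times_cont_differentiable (Suc k) f"
proof -
  have "frechet_derivative f (at x) = f' x" for x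
    using frechet_derivative_at[OF assms(1)] by simp
  then show ?thesis
    using assms by (auto simp: differentiable_def)
qed

lemma k_times_cont_differentiable_SucD:
  assumes "k_times_cont_differentiable (Suc k) f"
  shows "(f has_derivative frechet_derivative f (at x)) (at x)"
    and "k_times_cont_differentiable k (\<lambda>x. frechet_derivative f (at x) v)"
  using assms frechet_derivative_works by auto

lemma k_times_cont_differentiable_mono:
  "k_times_cont_differentiable (Suc k) f \<Longrightarrow> k_times_cont_differentiable k f"
proof (induction k arbitrary: f)
  case 0
  then show ?case
    by (auto intro: differentiable_imp_continuous_on simp: differentiable_on_def
        intro: differentiable_at_withinI)
next
  case (Suc k)
  then show ?case
    by (metis k_times_cont_differentiable.simps(2))
qed

lemma k_times_cont_differentiable_const:
  "k_times_cont_differentiable k (\<lambda>x::'a::euclidean_space. c)"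
proof (induction k arbitrary: c)
  case (Suc k)
  show ?case
    by (rule k_times_cont_differentiable_SucI[where f' = "\<lambda>x v. 0"]) (auto simp: Suc)
qed simp

lemma k_times_cont_differentiable_bounded_linear:
  fixes f :: "'a::euclidean_space \<Rightarrow> 'b::real_normed_vector"
  assumes "bounded_linear f"
  shows "k_times_cont_differentiable k f"
proof (cases k)
  case 0
  then show ?thesis using assms by (simp add: linear_continuous_on)
next
  case (Suc m)
  show ?thesis unfolding Suc
    by (rule k_times_cont_differentiable_SucI[where f' = "\<lambda>x. f"])
      (auto simp: bounded_linear_imp_has_derivative assms k_times_cont_differentiable_const)
qed

lemma k_times_cont_differentiable_linear_image:
  assumes "k_times_cont_differentiable k f" and "bounded_linear L"
  shows "k_times_cont_differentiable k (\<lambda>x. L (f x))"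
  using assms(1)
proof (induction k arbitrary: f)
  case 0
  then show ?case
    using assms(2) by (auto intro: bounded_linear.continuous_on)
next
  case (Suc k)
  show ?case
    by (rule k_times_cont_differentiable_SucI)
      (rule bounded_linear.has_derivative[OF assms(2)] k_times_cont_differentiable_SucD Suc)+
qed

lemma k_times_cont_differentiable_add:
  assumes "k_times_cont_differentiable k f" and "k_times_cont_differentiable k g"
  shows "k_times_cont_differentiable k (\<lambda>x. f x + g x)"
  using assms
proof (induction k arbitrary: f g)
  case 0
  then show ?case by (auto intro: continuous_intros)
next
  case (Suc k)
  show ?case
    by (rule k_times_cont_differentiable_SucI)
      (rule has_derivative_add k_times_cont_differentiable_SucD Suc)+
qed

lemma k_times_cont_differentiable_mult:
  fixes f g :: "'a::euclidean_space \<Rightarrow> real"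
  assumes "k_times_cont_differentiable k f" and "k_times_cont_differentiable k g"
  shows "k_times_cont_differentiable k (\<lambda>x. f x * g x)"
  using assms
proof (induction k arbitrary: f g)
  case 0
  then show ?case by (auto intro: continuous_intros)
next
  case (Suc k)
  show ?case
    by (rule k_times_cont_differentiable_SucI)
      (rule has_derivative_mult k_times_cont_differentiable_add k_times_cont_differentiable_SucD
        Suc k_times_cont_differentiable_mono)+
qed

text \<open>Chain rule for an outer function on the line. The sequence \<open>H\<close> lists the outer function together
with all its derivatives, which lets the induction on \<open>k\<close> pass from \<open>H j\<close> to \<open>H (Suc j)\<close>.\<close>

lemma k_times_cont_differentiable_compose:
  fixes c :: "'a::euclidean_space \<Rightarrow> real" and H :: "nat \<Rightarrow> real \<Rightarrow> real"
  assumes c: "\<And>k. k_times_cont_differentiable k c"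
    and H: "\<And>j t. (H j has_real_derivative H (Suc j) t) (at t)"
  shows "k_times_cont_differentiable k (\<lambda>x. H j (c x))"
proof (induction k arbitrary: j)
  case 0
  have "continuous_on UNIV (H j)"
    using H by (meson DERIV_continuous_on has_field_derivative_at_within)
  then show ?case
    using c[of 0] by (auto intro: continuous_on_compose2)
next
  case (Suc k)
  note c' = k_times_cont_differentiable_SucD[OF c[of "Suc _"]]
  have "((\<lambda>x. H j (c x)) has_derivative
      (\<lambda>v. frechet_derivative c (at x) v * H (Suc j) (c x))) (at x)" for x
    by (rule DERIV_compose_FDERIV[OF H c'(1)])
  then show ?case
    by (rule k_times_cont_differentiable_SucI)
      (intro k_times_cont_differentiable_mult c' Suc)
qed

lemma smooth_fun_const: "smooth_fun (\<lambda>x::'a::euclidean_space. c)"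
  by (simp add: smooth_fun_def k_times_cont_differentiable_const)

lemma smooth_fun_mult:
  fixes f g :: "'a::euclidean_space \<Rightarrow> real"
  shows "smooth_fun f \<Longrightarrow> smooth_fun g \<Longrightarrow> smooth_fun (\<lambda>x. f x * g x)"
  by (simp add: smooth_fun_def k_times_cont_differentiable_mult)

lemma smooth_fun_linear_image:
  "smooth_fun f \<Longrightarrow> bounded_linear L \<Longrightarrow> smooth_fun (\<lambda>x. L (f x))"
  by (simp add: smooth_fun_def k_times_cont_differentiable_linear_image)

lemma smooth_fun_real_polynomial_function:
  fixes f :: "'a::euclidean_space \<Rightarrow> real"
  shows "real_polynomial_function f \<Longrightarrow> smooth_fun f"
  by (induction rule: real_polynomial_function.induct)
    (auto simp: smooth_fun_def k_times_cont_differentiable_const k_times_cont_differentiable_add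
      k_times_cont_differentiable_mult k_times_cont_differentiable_bounded_linear)

lemma smooth_fun_has_derivative:
  "smooth_fun f \<Longrightarrow> (f has_derivative frechet_derivative f (at x)) (at x)"
  unfolding smooth_fun_def using k_times_cont_differentiable_SucD by blast

lemma smooth_fun_frechet_derivative:
  "smooth_fun f \<Longrightarrow> smooth_fun (\<lambda>x. frechet_derivative f (at x) v)"
  unfolding smooth_fun_def using k_times_cont_differentiable_SucD by blast

lemma smooth_fun_continuous: "smooth_fun f \<Longrightarrow> continuous_on A f"
  unfolding smooth_fun_def
  by (metis k_times_cont_differentiable.simps(1) continuous_on_subset subset_UNIV)

text \<open>For functions on a Euclidean space, compact support means vanishing outside some ball.\<close>

lemma C0_infinity_iff:
  fixes f :: "'a::euclidean_space \<Rightarrow> 'b::real_normed_vector"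
  shows "f \<in> C0_infinity \<longleftrightarrow> smooth_fun f \<and> (\<exists>R. \<forall>x. norm x > R \<longrightarrow> f x = 0)"
proof -
  have "compact (closure (support_on UNIV f)) \<longleftrightarrow> (\<exists>R. \<forall>x. norm x > R \<longrightarrow> f x = 0)"
    by (auto simp: compact_closure bounded_iff support_on_def linorder_not_le) 
      (metis linorder_not_le)+
  then show ?thesis
    by (simp add: C0_infinity_def smooth_fun_def)
qed

section \<open>A smooth bump function\<close>

text \<open>The function \<open>P(1/t) exp(-1/t)\<close>, extended by \<open>0\<close> to \<open>t \<le> 0\<close>. This family is closed under
differentiation: the derivative has the polynomial \<open>X\<^sup>2 (P - P')\<close> in place of \<open>P\<close>.\<close>

definition flat_exp :: "real poly \<Rightarrow> real \<Rightarrow> real" where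
  "flat_exp P t = (if t > 0 then poly P (1 / t) * exp (- (1 / t)) else 0)"

definition flat_exp_step :: "real poly \<Rightarrow> real poly" where
  "flat_exp_step P = [:0, 0, 1:] * (P - pderiv P)"

lemma poly_times_exp_neg_tendsto_0:
  fixes P :: "real poly"
  shows "((\<lambda>x. poly P x * exp (- x)) \<longlongrightarrow> 0) at_top"
proof -
  have "((\<lambda>x. \<Sum>i\<le>degree P. coeff P i * (x ^ i / exp x)) \<longlongrightarrow> (\<Sum>i\<le>degree P. coeff P i * 0)) at_top"
    by (intro tendsto_sum tendsto_mult tendsto_const tendsto_power_div_exp_0)
  moreover have "poly P x * exp (- x) = (\<Sum>i\<le>degree P. coeff P i * (x ^ i / exp x))" for x
    by (simp add: poly_altdef sum_distrib_right exp_minus divide_inverse mult.assoc)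
  ultimately show ?thesis by simp
qed

lemma flat_exp_tendsto_0: "(flat_exp P \<longlongrightarrow> 0) (at 0)"
proof -
  have "(flat_exp P \<longlongrightarrow> 0) (at_right 0)"
  proof (rule Lim_transform_eventually)
    have "filterlim (\<lambda>t::real. 1 / t) at_top (at_right 0)"
      using filterlim_inverse_at_top_right by (simp add: inverse_eq_divide)
    then show "((\<lambda>t. poly P (1 / t) * exp (- (1 / t))) \<longlongrightarrow> 0) (at_right 0)"
      by (rule filterlim_compose[OF poly_times_exp_neg_tendsto_0])
    show "\<forall>\<^sub>F t in at_right 0. poly P (1 / t) * exp (- (1 / t)) = flat_exp P t"
      by (auto simp: eventually_at_filter flat_exp_def)
  qed
  moreover have "(flat_exp P \<longlongrightarrow> 0) (at_left 0)"
    by (rule tendsto_eventually) (auto simp: eventually_at_filter flat_exp_def)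
  ultimately show ?thesis
    by (simp add: filterlim_at_split)
qed

lemma flat_exp_has_derivative:
  "(flat_exp P has_real_derivative flat_exp (flat_exp_step P) t) (at t)"
proof -
  consider "t < 0" | "t = 0" | "t > 0" by linarith
  then show ?thesis
  proof cases
    case 1
    have "((\<lambda>_. 0) has_real_derivative 0) (at t)" by simp
    then have "(flat_exp P has_real_derivative 0) (at t)"
      by (rule has_field_derivative_transform_within_open[where S = "{..<0}"])
        (use 1 in \<open>auto simp: flat_exp_def\<close>)
    then show ?thesis using 1 by (simp add: flat_exp_def)
  next
    case 2
    \<comment> \<open>The difference quotient at \<open>0\<close> is again in the family, with polynomial \<open>X P\<close>.\<close>
    have "((\<lambda>h. flat_exp ([:0, 1:] * P) h) \<longlongrightarrow> 0) (at 0)"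
      by (rule flat_exp_tendsto_0)
    moreover have "flat_exp ([:0, 1:] * P) h = flat_exp P h / h" for h
      by (simp add: flat_exp_def)
    ultimately have "((\<lambda>h. (flat_exp P (0 + h) - flat_exp P 0) / h) \<longlongrightarrow> 0) (at 0)"
      by (simp add: flat_exp_def[of P 0])
    then show ?thesis using 2 by (simp add: DERIV_def flat_exp_def)
  next
    case 3
    have "((\<lambda>t. poly P (1 / t) * exp (- (1 / t))) has_real_derivative
        flat_exp (flat_exp_step P) t) (at t)"
      using 3
      by (auto intro!: derivative_eq_intros poly_DERIV[THEN DERIV_chain2]
          simp: flat_exp_def flat_exp_step_def field_simps power2_eq_square)
    then show ?thesis
      by (rule has_field_derivative_transform_within_open[where S = "{0<..}"])
        (use 3 in \<open>auto simp: flat_exp_def\<close>)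
  qed
qed

text \<open>A smooth function that is positive exactly on the open ball of radius \<open>R\<close> around the origin
(for \<open>R > 0\<close>).\<close>

definition bump :: "real \<Rightarrow> 'a::euclidean_space \<Rightarrow> real" where
  "bump R x = flat_exp 1 (R\<^sup>2 - x \<bullet> x)"

lemma smooth_fun_bump: "smooth_fun (bump R :: 'a::euclidean_space \<Rightarrow> real)"
proof -
  let ?H = "\<lambda>j. flat_exp ((flat_exp_step ^^ j) 1)"
  have *: "smooth_fun (\<lambda>x::'a. R\<^sup>2 - x \<bullet> x)"
  proof (rule smooth_fun_real_polynomial_function)
    have "real_polynomial_function (\<lambda>x::'a. R\<^sup>2 + (-1) * (\<Sum>b\<in>Basis. (x \<bullet> b) * (x \<bullet> b)))"
      by (intro real_polynomial_function.intros real_polynomial_function_sum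
          bounded_linear_inner_left) auto
    then show "real_polynomial_function (\<lambda>x::'a. R\<^sup>2 - x \<bullet> x)"
      by (subst euclidean_inner) simp
  qed
  have "k_times_cont_differentiable k (\<lambda>x. ?H 0 (R\<^sup>2 - (x::'a) \<bullet> x))" for k
    by (rule k_times_cont_differentiable_compose)
      (use * in \<open>auto simp: smooth_fun_def flat_exp_has_derivative\<close>)
  then show ?thesis
    by (simp add: smooth_fun_def bump_def[abs_def])
qed

lemma bump_eq_0: "R \<ge> 0 \<Longrightarrow> norm x > R \<Longrightarrow> bump R x = 0"
  using power_strict_mono[of R "norm x" 2] by (simp add: bump_def flat_exp_def dot_square_norm)

lemma bump_bounds: "0 \<le> bump R x" "bump R x \<le> 1"
  by (auto simp: bump_def flat_exp_def)

lemma bump_lower_bound: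
  assumes "norm x \<le> R" "R \<ge> 0"
  shows "exp (- 1) \<le> bump (R + 1) x"
proof -
  have "(norm x)\<^sup>2 \<le> R\<^sup>2" using assms by (intro power_mono) auto
  then have "1 \<le> (R + 1)\<^sup>2 - x \<bullet> x"
    using assms by (simp add: dot_square_norm power2_eq_square algebra_simps)
  then show ?thesis by (simp add: bump_def flat_exp_def)
qed

text \<open>The map \<open>t \<mapsto> sin (\<pi> t / 2)\<close> fixes \<open>-1\<close>, \<open>0\<close> and \<open>1\<close> and takes values in \<open>[-1, 1]\<close>. Composing with
it truncates smooth approximations of a function with values in \<open>{-1, 0, 1}\<close> without leaving the
class of smooth functions.\<close>

lemma smooth_fun_sin:
  assumes "smooth_fun g"
  shows "smooth_fun (\<lambda>x. sin (g x * pi / 2))"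
proof -
  let ?H = "\<lambda>j t. (pi / 2) ^ j * sin (t * pi / 2 + real j * (pi / 2))"
  have H: "(?H j has_real_derivative ?H (Suc j) t) (at t)" for j t
  proof -
    have "cos (t * pi / 2 + real j * (pi / 2)) = sin (t * pi / 2 + real (Suc j) * (pi / 2))"
      by (simp add: sin_add cos_add algebra_simps add_divide_distrib)
    then show ?thesis
      by (auto intro!: derivative_eq_intros)
  qed
  have "k_times_cont_differentiable k (\<lambda>x. ?H 0 (g x))" for k
    using k_times_cont_differentiable_compose[of g ?H k 0, OF _ H] assms
    by (auto simp: smooth_fun_def)
  then show ?thesis
    by (simp add: smooth_fun_def)
qed

section \<open>Translations of Lebesgue measure\<close>

lemma lborel_shift_distr: "distr lborel borel (\<lambda>x::'a::euclidean_space. x + h) = lborel"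
proof -
  have "(\<lambda>x. x + h) = (+) h" by (simp add: fun_eq_iff add.commute)
  then show ?thesis using lborel_distr_plus[of h] by simp
qed

lemma nn_integral_lborel_shift:
  fixes F :: "'a::euclidean_space \<Rightarrow> ennreal"
  assumes "F \<in> borel_measurable borel"
  shows "(\<integral>\<^sup>+x. F (x + h) \<partial>lborel) = (\<integral>\<^sup>+x. F x \<partial>lborel)"
  by (subst (2) lborel_shift_distr[of h, symmetric]) (use assms in \<open>simp add: nn_integral_distr\<close>)

lemma AE_lborel_shift:
  fixes P :: "'a::euclidean_space \<Rightarrow> bool"
  assumes "{x. P x} \<in> sets borel"
  shows "(AE x in lborel. P (x + h)) \<longleftrightarrow> (AE x in lborel. P x)"
  by (subst (2) lborel_shift_distr[of h, symmetric]) (use assms in \<open>simp add: AE_distr_iff\<close>)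

lemma integral_lborel_shift:
  fixes F :: "'a::euclidean_space \<Rightarrow> real"
  assumes "F \<in> borel_measurable borel"
  shows "(LINT x|lborel. F (x + h)) = (LINT x|lborel. F x)"
  by (subst (2) lborel_shift_distr[of h, symmetric]) (use assms in \<open>simp add: integral_distr\<close>)

lemma integrable_lborel_shift:
  fixes F :: "'a::euclidean_space \<Rightarrow> real"
  assumes "F \<in> borel_measurable borel"
  shows "integrable lborel (\<lambda>x. F (x + h)) \<longleftrightarrow> integrable lborel F"
  by (subst (2) lborel_shift_distr[of h, symmetric]) (use assms in \<open>simp add: integrable_distr_eq\<close>)

section \<open>\<open>L\<^sup>p\<close>-norms and the Hoelder inequality\<close>

lemma exponent_cases:
  fixes q :: ereal
  assumes "1 \<le> q"
  obtains "q = \<infinity>" | r where "q = ereal r" "1 \<le> r"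
  using assms by (cases q) auto

lemma dual_exponent_cases:
  assumes "1 \<le> p"
  obtains "p = 1" "dual_exponent p = \<infinity>"
  | "p = \<infinity>" "dual_exponent p = 1"
  | r s where "p = ereal r" "dual_exponent p = ereal s" "1 < r" "1 < s" "1 / r + 1 / s = 1"
proof (cases p)
  case (real r)
  show ?thesis
  proof (cases "r = 1")
    case True
    then show ?thesis using real that(1) by (simp add: dual_exponent_def one_ereal_def)
  next
    case False
    then have "1 < r" using assms real by simp
    moreover have "dual_exponent p = ereal (r / (r - 1))"
      using False real \<open>1 < r\<close> by (simp add: dual_exponent_def one_ereal_def)
    moreover have "1 < r / (r - 1)" "1 / r + 1 / (r / (r - 1)) = 1"
      using \<open>1 < r\<close> by (auto simp: field_simps)
    ultimately show ?thesis using real that(3) by blast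
  qed
qed (use assms that(2) in \<open>auto simp: dual_exponent_def\<close>)

lemma dual_exponent_ge_1: "1 \<le> p \<Longrightarrow> 1 \<le> dual_exponent p"
  by (erule dual_exponent_cases) (auto simp: one_ereal_def)

text \<open>The norms are only ever compared with finite constants. This lemma and the next one express such a
bound by an integral over Borel measure, respectively by an almost everywhere bound.\<close>

lemma Lp_norm_le_iff:
  assumes "1 \<le> r" "0 \<le> c"
  shows "Lp_norm (ereal r) f \<le> ereal c \<longleftrightarrow>
    (\<integral>\<^sup>+x. ennreal (norm (f x) powr r) \<partial>lborel) \<le> ennreal (c powr r)"
proof -
  define I where "I = (\<integral>\<^sup>+x. ennreal (norm (f x) powr r) \<partial>lborel)"
  show ?thesis
  proof (cases "I = \<infinity>")
    case True
    then show ?thesis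
      by (simp add: Lp_norm_def nn_integral_completion Let_def top_unique flip: I_def)
  next
    case False
    then obtain a where a: "I = ennreal a" "a \<ge> 0"
      by (cases I) auto
    have "a powr (1 / r) \<le> c \<longleftrightarrow> a \<le> c powr r"
    proof
      assume "a powr (1 / r) \<le> c"
      then have "(a powr (1 / r)) powr r \<le> c powr r"
        using assms by (intro powr_mono2) auto
      then show "a \<le> c powr r" using a assms by (simp add: powr_powr)
    next
      assume "a \<le> c powr r"
      then have "a powr (1 / r) \<le> (c powr r) powr (1 / r)"
        using assms a by (intro powr_mono2) auto
      then show "a powr (1 / r) \<le> c" using assms by (simp add: powr_powr)
    qed
    then show ?thesis
      using a False
      by (simp add: Lp_norm_def nn_integral_completion Let_def flip: I_def)
  qed
qed

lemma Lp_norm_infinity_le_iff: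
  fixes f :: "'a::euclidean_space \<Rightarrow> 'b::real_normed_vector"
  assumes "(\<lambda>x. norm (f x)) \<in> borel_measurable lebesgue"
  shows "Lp_norm \<infinity> f \<le> ereal c \<longleftrightarrow> (AE x in lborel. norm (f x) \<le> c)"
proof -
  have m: "(\<lambda>x. ereal (norm (f x))) \<in> borel_measurable lebesgue" using assms by measurable
  have "Lp_norm \<infinity> f \<le> ereal c \<longleftrightarrow> (AE x in lebesgue. norm (f x) \<le> c)"
  proof
    assume *: "Lp_norm \<infinity> f \<le> ereal c"
    have "AE x in lebesgue. ereal (norm (f x)) \<le> Lp_norm \<infinity> f"
      unfolding Lp_norm_def by (simp add: esssup_AE)
    then show "AE x in lebesgue. norm (f x) \<le> c"
    proof eventually_elim
      case (elim x)
      then have "ereal (norm (f x)) \<le> ereal c" using * by (rule order_trans)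
      then show ?case by simp
    qed
  qed (auto simp: Lp_norm_def intro!: esssup_I m)
  then show ?thesis by (simp add: AE_completion_iff)
qed

lemma Lp_norm_mono_AE:
  fixes f :: "'a::euclidean_space \<Rightarrow> 'b::real_normed_vector"
    and g :: "'a \<Rightarrow> 'c::real_normed_vector"
  assumes "1 \<le> q" and f: "(\<lambda>x. norm (f x)) \<in> borel_measurable lebesgue"
    and le: "AE x in lborel. norm (f x) \<le> norm (g x)"
  shows "Lp_norm q f \<le> Lp_norm q g"
  using assms(1)
proof (cases rule: exponent_cases)
  case 1
  have "AE x in lebesgue. ereal (norm (f x)) \<le> ereal (norm (g x))"
    using le by (simp add: AE_completion_iff)
  moreover have "(\<lambda>x. ereal (norm (f x))) \<in> borel_measurable lebesgue" using f by measurable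
  ultimately show ?thesis using 1 by (simp add: Lp_norm_def esssup_AE_mono)
next
  case (2 r)
  have le': "(\<integral>\<^sup>+x. ennreal (norm (f x) powr r) \<partial>lborel)
      \<le> (\<integral>\<^sup>+x. ennreal (norm (g x) powr r) \<partial>lborel)"
  proof (rule nn_integral_mono_AE)
    show "AE x in lborel. ennreal (norm (f x) powr r) \<le> ennreal (norm (g x) powr r)"
      using le by eventually_elim (use 2 in \<open>simp add: powr_mono2 ennreal_leI\<close>)
  qed
  show ?thesis
  proof (cases "Lp_norm q g")
    case (real c)
    have "Lp_norm q g \<ge> 0" by (simp add: Lp_norm_def Let_def 2)
    then have "c \<ge> 0" using real by simp
    then show ?thesis
      using real le' 2 Lp_norm_le_iff[of r c g] Lp_norm_le_iff[of r c f] by auto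
  qed (auto simp: Lp_norm_def Let_def 2 split: if_splits)
qed

lemma Lp_norm_cong_AE:
  fixes f :: "'a::euclidean_space \<Rightarrow> 'b::real_normed_vector"
    and g :: "'a \<Rightarrow> 'c::real_normed_vector"
  assumes "1 \<le> q" "(\<lambda>x. norm (f x)) \<in> borel_measurable lebesgue"
    "(\<lambda>x. norm (g x)) \<in> borel_measurable lebesgue"
    and "AE x in lborel. norm (f x) = norm (g x)"
  shows "Lp_norm q f = Lp_norm q g"
  using assms by (intro antisym Lp_norm_mono_AE) (auto elim!: eventually_mono)

lemma borel_measurable_lebesgueI:
  "f \<in> borel_measurable borel \<Longrightarrow> f \<in> borel_measurable lebesgue"
  by (rule measurable_completion) simp

lemma Lp_norm_infinity_le_iff_borel:
  fixes f :: "'a::euclidean_space \<Rightarrow> real"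
  assumes [measurable]: "f \<in> borel_measurable borel"
  shows "Lp_norm \<infinity> f \<le> ereal c \<longleftrightarrow> (AE x in lborel. \<bar>f x\<bar> \<le> c)"
  by (subst Lp_norm_infinity_le_iff) (auto intro: borel_measurable_lebesgueI)

lemma Lp_norm_shift_le:
  fixes g :: "'a::euclidean_space \<Rightarrow> real"
  assumes "1 \<le> q" "0 \<le> c" and [measurable]: "g \<in> borel_measurable borel"
    and le: "Lp_norm q g \<le> ereal c"
  shows "Lp_norm q (\<lambda>x. g (x + h)) \<le> ereal c"
  using assms(1)
proof (cases rule: exponent_cases)
  case 1
  have "AE x in lborel. norm (g x) \<le> c"
    using le 1 by (simp add: Lp_norm_infinity_le_iff_borel)
  then have "AE x in lborel. norm (g (x + h)) \<le> c"
    by (subst AE_lborel_shift[of "\<lambda>x. norm (g x) \<le> c"]) auto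
  then show ?thesis
    unfolding 1 by (simp add: Lp_norm_infinity_le_iff_borel)
next
  case (2 r)
  show ?thesis
    using le assms 2 nn_integral_lborel_shift[of "\<lambda>x. ennreal (norm (g x) powr r)" h]
    by (simp add: Lp_norm_le_iff)
qed

text \<open>Positive bounds \<open>a\<close> and \<open>b\<close> make Young's inequality applicable to \<open>|g|/a\<close> and \<open>|u|/b\<close>.\<close>

lemma Lp_Holder:
  fixes g u :: "'a::euclidean_space \<Rightarrow> real"
  assumes p: "1 \<le> p" and [measurable]: "g \<in> borel_measurable borel" "u \<in> borel_measurable borel"
    and g: "Lp_norm (dual_exponent p) g \<le> ereal a" and u: "Lp_norm p u \<le> ereal b"
    and a: "0 < a" and b: "0 < b"
  shows "(\<integral>\<^sup>+x. ennreal \<bar>g x * u x\<bar> \<partial>lborel) \<le> ennreal (a * b)"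
proof -
  have L1: "(\<integral>\<^sup>+x. ennreal \<bar>g x * u x\<bar> \<partial>lborel) \<le> ennreal (a * b)"
    if [measurable]: "g \<in> borel_measurable borel" "u \<in> borel_measurable borel"
      and g: "Lp_norm \<infinity> g \<le> ereal a" and u: "Lp_norm 1 u \<le> ereal b"
      and ab: "0 < a" "0 < b" for g u :: "'a \<Rightarrow> real" and a b
  proof -
    have "AE x in lborel. \<bar>g x\<bar> \<le> a"
      using g by (simp add: Lp_norm_infinity_le_iff_borel)
    then have "(\<integral>\<^sup>+x. ennreal \<bar>g x * u x\<bar> \<partial>lborel) \<le> (\<integral>\<^sup>+x. ennreal a * ennreal \<bar>u x\<bar> \<partial>lborel)"
      by (intro nn_integral_mono_AE)
        (auto elim!: eventually_mono simp: abs_mult simp flip: ennreal_mult'' intro!: ennreal_leI mult_right_mono)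
    also have "\<dots> = ennreal a * (\<integral>\<^sup>+x. ennreal \<bar>u x\<bar> \<partial>lborel)"
      by (rule nn_integral_cmult) auto
    also have "(\<integral>\<^sup>+x. ennreal \<bar>u x\<bar> \<partial>lborel) \<le> ennreal b"
      using u ab Lp_norm_le_iff[of 1 b u] by (simp add: one_ereal_def)
    finally show ?thesis
      using ab by (simp add: ennreal_mult mult_left_mono)
  qed
  show ?thesis
    using p
  proof (cases rule: dual_exponent_cases)
    case 1
    then show ?thesis using L1[of g u a b] assms by simp
  next
    case 2
    then show ?thesis using L1[of u g b a] assms by (simp add: mult.commute)
  next
    case (3 r s)
    define G where "G = (\<integral>\<^sup>+x. ennreal (\<bar>g x\<bar> powr s) \<partial>lborel)"
    define W where "W = (\<integral>\<^sup>+x. ennreal (\<bar>u x\<bar> powr r) \<partial>lborel)"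
    have G: "G \<le> ennreal (a powr s)" and W: "W \<le> ennreal (b powr r)"
      using g u 3 a b by (auto simp: Lp_norm_le_iff G_def W_def)
    define \<alpha> \<beta> where "\<alpha> = a * b / (s * a powr s)" and "\<beta> = a * b / (r * b powr r)"
    have pos: "\<alpha> \<ge> 0" "\<beta> \<ge> 0" using a b 3 by (auto simp: \<alpha>_def \<beta>_def)
    have "\<bar>g x * u x\<bar> \<le> \<alpha> * \<bar>g x\<bar> powr s + \<beta> * \<bar>u x\<bar> powr r" for x
    proof -
      have "(\<bar>g x\<bar> / a) * (\<bar>u x\<bar> / b) \<le> (\<bar>g x\<bar> / a) powr s / s + (\<bar>u x\<bar> / b) powr r / r"
        using 3 a b by (intro Youngs_inequality) auto
      then have "(a * b) * ((\<bar>g x\<bar> / a) * (\<bar>u x\<bar> / b))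
          \<le> (a * b) * ((\<bar>g x\<bar> / a) powr s / s + (\<bar>u x\<bar> / b) powr r / r)"
        using a b by (intro mult_left_mono) auto
      then show ?thesis
        using a b by (simp add: \<alpha>_def \<beta>_def powr_divide abs_mult distrib_left mult_ac)
    qed
    then have "(\<integral>\<^sup>+x. ennreal \<bar>g x * u x\<bar> \<partial>lborel)
        \<le> (\<integral>\<^sup>+x. ennreal \<alpha> * ennreal (\<bar>g x\<bar> powr s) + ennreal \<beta> * ennreal (\<bar>u x\<bar> powr r) \<partial>lborel)"
      using pos by (intro nn_integral_mono) (simp flip: ennreal_mult ennreal_plus)
    also have "\<dots> = ennreal \<alpha> * G + ennreal \<beta> * W"
      unfolding G_def W_def by (simp add: nn_integral_add nn_integral_cmult)
    also have "\<dots> \<le> ennreal \<alpha> * ennreal (a powr s) + ennreal \<beta> * ennreal (b powr r)"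
      using G W by (intro add_mono mult_left_mono) auto
    also have "\<dots> = ennreal (\<alpha> * a powr s + \<beta> * b powr r)"
      using pos by (simp flip: ennreal_mult)
    also have "\<alpha> * a powr s + \<beta> * b powr r = a * b * (1 / r + 1 / s)"
      using a b 3(3,4) by (simp add: \<alpha>_def \<beta>_def distrib_left)
    finally show ?thesis using 3 by simp
  qed
qed

lemma abs_integral_le_nn_integral:
  fixes F :: "'a \<Rightarrow> real"
  assumes "(\<integral>\<^sup>+x. ennreal \<bar>F x\<bar> \<partial>M) \<le> ennreal c" "0 \<le> c"
  shows "\<bar>integral\<^sup>L M F\<bar> \<le> c"
proof (cases "integrable M F")
  case True
  from integral_norm_bound_ennreal[OF this] assms(1)
  have "ennreal \<bar>integral\<^sup>L M F\<bar> \<le> ennreal c" by simp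
  then show ?thesis using assms(2) by simp
qed (simp add: not_integrable_integral_eq assms)

lemma Lp_Holder_integral:
  fixes g u :: "'a::euclidean_space \<Rightarrow> real"
  assumes "1 \<le> p" "g \<in> borel_measurable borel" "u \<in> borel_measurable borel"
    and "Lp_norm (dual_exponent p) g \<le> ereal a" and u: "Lp_norm p u \<le> ereal b"
    and a: "0 < a" and b: "0 \<le> b"
  shows "\<bar>LINT x|lborel. g x * u x\<bar> \<le> a * b"
proof (rule field_le_epsilon)
  fix e :: real assume e: "0 < e"
  have "Lp_norm p u \<le> ereal (b + e / a)"
    using u by (rule order_trans) (use a e in simp)
  then have "\<bar>LINT x|lborel. g x * u x\<bar> \<le> a * (b + e / a)"
    using assms e by (intro abs_integral_le_nn_integral Lp_Holder[of p]) (auto intro: add_nonneg_pos)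
  then show "\<bar>LINT x|lborel. g x * u x\<bar> \<le> a * b + e" using a by (simp add: distrib_left)
qed

section \<open>Locally integrable functions\<close>

lemma sets_borel_cball [measurable]: "cball (a::'a::euclidean_space) R \<in> sets borel"
  by simp

text \<open>Borel functions that are integrable over every ball. The arguments below use no more about the
function whose modulus is estimated.\<close>

definition loc_integrable :: "('a::euclidean_space \<Rightarrow> real) \<Rightarrow> bool" where
  "loc_integrable u \<longleftrightarrow> u \<in> borel_measurable borel \<and>
    (\<forall>R. integrable lborel (\<lambda>x. indicator (cball 0 R) x * u x))"

lemma loc_integrable_measurable: "loc_integrable u \<Longrightarrow> u \<in> borel_measurable borel"
  by (simp add: loc_integrable_def)

lemma loc_integrable_mult:
  fixes g u :: "'a::euclidean_space \<Rightarrow> real"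
  assumes u: "loc_integrable u" and [measurable]: "g \<in> borel_measurable borel"
    and M: "\<And>x. \<bar>g x\<bar> \<le> M" and R: "\<And>x. norm x > R \<Longrightarrow> g x = 0"
  shows "integrable lborel (\<lambda>x. g x * u x)"
proof (rule Bochner_Integration.integrable_bound)
  have [measurable]: "u \<in> borel_measurable borel" using u by (rule loc_integrable_measurable)
  show "integrable lborel (\<lambda>x. M * (indicator (cball 0 R) x * u x))"
    using u unfolding loc_integrable_def by (intro integrable_mult_right) auto
  show "(\<lambda>x. g x * u x) \<in> borel_measurable lborel" by measurable
  have "M \<ge> 0" using M[of 0] by linarith
  have "norm (g x * u x) \<le> norm (M * (indicator (cball 0 R) x * u x))" for x
    using M[of x] R[of x] \<open>M \<ge> 0\<close>
    by (cases "norm x > R") (auto simp: abs_mult indicator_def intro!: mult_right_mono)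
  then show "AE x in lborel. norm (g x * u x) \<le> norm (M * (indicator (cball 0 R) x * u x))"
    by simp
qed

lemma loc_integrable_shift:
  fixes u :: "'a::euclidean_space \<Rightarrow> real"
  assumes u: "loc_integrable u"
  shows "loc_integrable (\<lambda>x. u (x + h))"
proof -
  have [measurable]: "u \<in> borel_measurable borel" using u by (rule loc_integrable_measurable)
  have "integrable lborel (\<lambda>x. indicator (cball 0 R) x * u (x + h))" for R
  proof -
    have "integrable lborel (\<lambda>x. indicator (cball 0 R) (x - h) * u x)"
    proof (rule loc_integrable_mult[OF u, where M = 1 and R = "R + norm h"])
      show "indicator (cball 0 R) (x - h) = (0::real)" if "R + norm h < norm x" for x :: 'a
        using that norm_triangle_ineq2[of x h] by simp
    qed (auto simp: indicator_def)
    then show ?thesis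
      using integrable_lborel_shift[of "\<lambda>x. indicator (cball 0 R) (x - h) * u x" h] by simp
  qed
  then show ?thesis unfolding loc_integrable_def by simp
qed

lemma loc_integrable_diff:
  assumes "loc_integrable u" "loc_integrable v"
  shows "loc_integrable (\<lambda>x. u x - v x)"
  using assms unfolding loc_integrable_def
  by (auto simp: right_diff_distrib intro!: borel_measurable_diff)

lemma Lp_norm_finite_imp_loc_integrable:
  fixes u :: "'a::euclidean_space \<Rightarrow> real"
  assumes p: "1 \<le> p" and [measurable]: "u \<in> borel_measurable borel" and "Lp_norm p u < \<infinity>"
  shows "loc_integrable u"
proof -
  obtain c where c: "Lp_norm p u \<le> ereal c" "c \<ge> 0"
  proof (cases "Lp_norm p u")
    case (real r)
    then show ?thesis using that[of "max r 0"] by simp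
  qed (use assms that[of 0] in auto)
  have "integrable lborel (\<lambda>x. indicator (cball 0 R) x * u x)" for R
  proof (rule integrableI_bounded)
    have I: "(\<integral>\<^sup>+x. indicator (cball (0::'a) R) x \<partial>lborel) < \<infinity>"
      using emeasure_bounded_finite[OF bounded_cball[of "0::'a" R]] by simp
    show "(\<integral>\<^sup>+x. ennreal (norm (indicator (cball 0 R) x * u x)) \<partial>lborel) < \<infinity>"
      using p
    proof (cases rule: exponent_cases)
      case 1
      have "AE x in lborel. \<bar>u x\<bar> \<le> c"
        using c 1 by (simp add: Lp_norm_infinity_le_iff_borel)
      then have "AE x in lborel. ennreal (norm (indicator (cball 0 R) x * u x))
          \<le> ennreal c * indicator (cball (0::'a) R) x"
        by eventually_elim (simp add: indicator_def ennreal_leI)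
      then have "(\<integral>\<^sup>+x. ennreal (norm (indicator (cball 0 R) x * u x)) \<partial>lborel)
          \<le> (\<integral>\<^sup>+x. ennreal c * indicator (cball (0::'a) R) x \<partial>lborel)"
        by (rule nn_integral_mono_AE)
      also have "\<dots> < \<infinity>" using I by (simp add: nn_integral_cmult_indicator ennreal_mult_less_top)
      finally show ?thesis .
    next
      case (2 r)
      have "\<bar>u x\<bar> \<le> 1 + \<bar>u x\<bar> powr r" for x
      proof (cases "\<bar>u x\<bar> \<le> 1")
        case False
        then have "\<bar>u x\<bar> powr 1 \<le> \<bar>u x\<bar> powr r" using 2 by (intro powr_mono) auto
        then show ?thesis using False by simp
      qed (simp add: add_increasing2)
      then have "(\<integral>\<^sup>+x. ennreal (norm (indicator (cball 0 R) x * u x)) \<partial>lborel)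
          \<le> (\<integral>\<^sup>+x. indicator (cball 0 R) x + ennreal (\<bar>u x\<bar> powr r) \<partial>lborel)"
        by (intro nn_integral_mono) (auto simp: indicator_def simp flip: ennreal_plus ennreal_1)
      also have "\<dots> = (\<integral>\<^sup>+x. indicator (cball (0::'a) R) x \<partial>lborel)
          + (\<integral>\<^sup>+x. ennreal (\<bar>u x\<bar> powr r) \<partial>lborel)"
        by (rule nn_integral_add) auto
      also have "\<dots> < \<infinity>"
        using I c 2 Lp_norm_le_iff[of r c u] by (auto simp: less_top[symmetric] top_unique)
      finally show ?thesis .
    qed
  qed (simp add: borel_measurable_times)
  then show ?thesis by (simp add: loc_integrable_def)
qed

section \<open>Averages along segments\<close>

text \<open>The average of \<open>g\<close> over the segment from \<open>x\<close> to \<open>x + v\<close>, as a function of \<open>x\<close>. The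
Henstock-Kurzweil integral gives direct access to differentiation under the integral; for Fubini's
theorem it is rewritten as an integral over the uniform distribution on \<open>[0, 1]\<close>.\<close>

definition segment_average :: "'a::euclidean_space \<Rightarrow> ('a \<Rightarrow> real) \<Rightarrow> 'a \<Rightarrow> real" where
  "segment_average v g x = integral {0..1} (\<lambda>r. g (x + r *\<^sub>R v))"

text \<open>The uniform distribution on \<open>[0, 1]\<close>, as a density over the Borel sets of the whole line, so that
Borel measurability can be used for it unchanged.\<close>

definition unit_uniform :: "real measure" where
  "unit_uniform = density lborel (\<lambda>r. ennreal (indicator {0..1} r))"

lemma sets_unit_uniform [simp, measurable_cong]: "sets unit_uniform = sets borel"
  by (simp add: unit_uniform_def)

lemma space_unit_uniform [simp]: "space unit_uniform = UNIV"
  by (simp add: unit_uniform_def)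

lemma prob_space_unit_uniform: "prob_space unit_uniform"
  by standard (simp add: unit_uniform_def emeasure_density ennreal_indicator)

interpretation unit_uniform: prob_space unit_uniform
  by (rule prob_space_unit_uniform)

interpretation unit_lborel: pair_sigma_finite unit_uniform "lborel :: 'a::euclidean_space measure"
  ..

lemma AE_unit_uniform: "AE r in unit_uniform. r \<in> {0..1}"
  unfolding unit_uniform_def
  by (subst AE_density) (auto simp: indicator_def)

lemma continuous_on_line:
  assumes "continuous_on UNIV (g :: 'a::euclidean_space \<Rightarrow> real)"
  shows "continuous_on A (\<lambda>r. g (x + r *\<^sub>R v))"
  by (rule continuous_on_compose2[OF assms]) (auto intro!: continuous_intros)

lemma unit_uniform_integral:
  fixes h :: "real \<Rightarrow> real"
  assumes "continuous_on UNIV h"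
  shows "integrable unit_uniform h" and "(LINT r|unit_uniform. h r) = integral {0..1} h"
proof -
  have [measurable]: "h \<in> borel_measurable borel"
    using assms by (rule borel_measurable_continuous_onI)
  have *: "integrable lborel (\<lambda>r. indicator {0..1} r *\<^sub>R h r)"
    by (rule borel_integrable_compact) (use assms continuous_on_subset in auto)
  then show "integrable unit_uniform h"
    unfolding unit_uniform_def by (subst integrable_density) auto
  have "(LINT r|unit_uniform. h r) = (LINT r|lborel. indicator {0..1} r *\<^sub>R h r)"
    unfolding unit_uniform_def by (subst integral_density) auto
  also have "\<dots> = integral {0..1} h"
    using set_borel_integral_eq_integral(2)[of "{0..1}" h] *
    by (simp add: set_integrable_def set_lebesgue_integral_def)
  finally show "(LINT r|unit_uniform. h r) = integral {0..1} h" .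
qed

lemma segment_average_eq:
  assumes "continuous_on UNIV g"
  shows "segment_average v g x = (LINT r|unit_uniform. g (x + r *\<^sub>R v))"
  unfolding segment_average_def
  by (rule unit_uniform_integral(2)[symmetric]) (rule continuous_on_line[OF assms])

lemma continuous_on_segment_average:
  assumes "continuous_on UNIV g"
  shows "continuous_on UNIV (segment_average v g)"
proof -
  have "continuous_on (UNIV \<times> cbox 0 1) (\<lambda>(x, r::real). g (x + r *\<^sub>R v))"
    unfolding split_beta
    by (rule continuous_on_compose2[OF assms]) (auto intro!: continuous_intros)
  then have "continuous_on UNIV (\<lambda>x. integral (cbox 0 1) (\<lambda>r::real. g (x + r *\<^sub>R v)))"
    by (rule integral_continuous_on_param)
  then show ?thesis by (simp add: segment_average_def[abs_def])
qed

lemma segment_average_support: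
  assumes "\<And>x. norm x > R \<Longrightarrow> g x = 0" and x: "norm x > R + norm v"
  shows "segment_average v g x = 0"
proof -
  have "g (x + r *\<^sub>R v) = 0" if "r \<in> {0..1}" for r
  proof (rule assms(1))
    have "norm (r *\<^sub>R v) \<le> norm v" using that by (simp add: mult_left_le_one_le)
    then show "R < norm (x + r *\<^sub>R v)"
      using norm_diff_ineq[of x "r *\<^sub>R v"] x by linarith
  qed
  then have "segment_average v g x = integral {0..1} (\<lambda>r::real. 0)"
    unfolding segment_average_def by (intro integral_cong) simp
  then show ?thesis by simp
qed

lemma segment_average_commute:
  assumes "continuous_on UNIV g"
  shows "segment_average v (segment_average w g) x = segment_average w (segment_average v g) x"
proof -
  have "continuous_on (cbox (0, 0) (1, 1)) (\<lambda>(r, s). g (x + r *\<^sub>R v + s *\<^sub>R w))"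
    unfolding split_beta
    by (rule continuous_on_compose2[OF assms]) (auto intro!: continuous_intros)
  from integral_swap_continuous[OF this] show ?thesis
    by (simp add: segment_average_def algebra_simps)
qed

lemma segment_average_sum:
  assumes "\<And>i. i \<in> I \<Longrightarrow> continuous_on UNIV (g i)" "finite I"
  shows "segment_average v (\<lambda>y. \<Sum>i\<in>I. g i y) x = (\<Sum>i\<in>I. segment_average v (g i) x)"
  unfolding segment_average_def
  by (rule integral_sum) (auto intro!: integrable_continuous_interval continuous_on_line assms)

lemma segment_average_diff_shift:
  assumes "continuous_on UNIV g"
  shows "segment_average v (\<lambda>y. g (y + h) - g y) x
    = segment_average v g (x + h) - segment_average v g x"
proof -
  have "integral {0..1} (\<lambda>r. g (x + h + r *\<^sub>R v) - g (x + r *\<^sub>R v))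
      = integral {0..1} (\<lambda>r. g (x + h + r *\<^sub>R v)) - integral {0..1} (\<lambda>r. g (x + r *\<^sub>R v))"
    by (rule integral_diff) (auto intro!: integrable_continuous_interval continuous_on_line assms)
  then show ?thesis
    by (simp add: segment_average_def algebra_simps)
qed

lemma segment_average_cmult:
  "segment_average v (\<lambda>y. c * g y) x = c * segment_average v g x"
  by (simp add: segment_average_def)

text \<open>The fundamental theorem of calculus along the segment: averaging a derivative in direction \<open>v\<close> over
a segment in the same direction leaves a difference, in which no derivative occurs.\<close>

lemma segment_average_frechet_derivative:
  assumes "smooth_fun g"
  shows "segment_average v (\<lambda>y. frechet_derivative g (at y) v) x = g (x + v) - g x"
proof -
  have "((\<lambda>r. g (x + r *\<^sub>R v)) has_vector_derivative
      frechet_derivative g (at (x + r *\<^sub>R v)) v) (at r within {0..1})" for r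
  proof -
    have "((\<lambda>r. g (x + r *\<^sub>R v)) has_derivative
        (\<lambda>s. frechet_derivative g (at (x + r *\<^sub>R v)) (s *\<^sub>R v))) (at r within {0..1})"
      by (rule has_derivative_compose[OF _ smooth_fun_has_derivative[OF assms]])
        (auto intro!: derivative_eq_intros)
    moreover have "linear (frechet_derivative g (at (x + r *\<^sub>R v)))"
      using smooth_fun_has_derivative[OF assms] has_derivative_linear by blast
    ultimately show ?thesis
      by (simp add: has_vector_derivative_def linear_cmul)
  qed
  then have "((\<lambda>r. frechet_derivative g (at (x + r *\<^sub>R v)) v) has_integral
      (g (x + 1 *\<^sub>R v) - g (x + 0 *\<^sub>R v))) {0..1}"
    by (intro fundamental_theorem_of_calculus) auto
  then show ?thesis
    by (simp add: segment_average_def integral_unique)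
qed

lemma segment_average_has_derivative:
  fixes g :: "'a::euclidean_space \<Rightarrow> real"
  assumes g: "k_times_cont_differentiable (Suc 0) g"
  shows "(segment_average v g has_derivative
    (\<lambda>w. segment_average v (\<lambda>y. frechet_derivative g (at y) w) x)) (at x)"
proof -
  note gd = k_times_cont_differentiable_SucD[OF g]
  define D where "D y = Blinfun (frechet_derivative g (at y))" for y
  have bl: "bounded_linear (frechet_derivative g (at y))" for y
    using gd(1) by (rule has_derivative_bounded_linear)
  have D: "blinfun_apply (D y) = frechet_derivative g (at y)" for y
    unfolding D_def by (rule bounded_linear_Blinfun_apply[OF bl])
  have contg: "continuous_on UNIV g"
    using k_times_cont_differentiable_mono[OF g] by simp
  have contD: "continuous_on UNIV D"
    by (rule continuous_on_blinfun_componentwise) (use gd(2) in \<open>simp add: D\<close>)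
  have cont: "continuous_on (UNIV \<times> cbox 0 1) (\<lambda>(x, r::real). D (x + r *\<^sub>R v))"
    unfolding split_beta
    by (rule continuous_on_compose2[OF contD]) (auto intro!: continuous_intros)
  have "((\<lambda>x. integral (cbox 0 1) (\<lambda>r::real. g (x + r *\<^sub>R v))) has_derivative
      blinfun_apply (integral (cbox 0 1) (\<lambda>r. D (x + r *\<^sub>R v)))) (at x within UNIV)"
  proof (rule leibniz_rule[OF _ _ cont])
    show "((\<lambda>x. g (x + r *\<^sub>R v)) has_derivative blinfun_apply (D (y + r *\<^sub>R v))) (at y within UNIV)"
      for y r
      unfolding D by (rule has_derivative_compose[OF _ gd(1)]) (auto intro!: derivative_eq_intros)
    show "(\<lambda>r::real. g (y + r *\<^sub>R v)) integrable_on cbox 0 1" for y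
      using continuous_on_line[OF contg] by (simp add: integrable_continuous_interval)
  qed auto
  moreover have "blinfun_apply (integral (cbox 0 1) (\<lambda>r. D (x + r *\<^sub>R v)))
      = (\<lambda>w. segment_average v (\<lambda>y. frechet_derivative g (at y) w) x)"
  proof
    fix w
    have "continuous_on (cbox 0 1) (\<lambda>r. D (x + r *\<^sub>R v))"
      by (rule continuous_on_compose2[OF contD]) (auto intro!: continuous_intros)
    then have "(\<lambda>r. D (x + r *\<^sub>R v)) integrable_on cbox 0 1"
      by (rule integrable_continuous)
    from blinfun_apply_integral[OF this]
    show "blinfun_apply (integral (cbox 0 1) (\<lambda>r. D (x + r *\<^sub>R v))) w
        = segment_average v (\<lambda>y. frechet_derivative g (at y) w) x"
      by (simp add: D segment_average_def)
  qed
  ultimately show ?thesis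
    unfolding segment_average_def[abs_def] by simp
qed

lemma smooth_fun_segment_average:
  assumes "smooth_fun g"
  shows "smooth_fun (segment_average v g)"
proof -
  have "k_times_cont_differentiable k (segment_average v g)"
    if "smooth_fun g" for k and g :: "'a \<Rightarrow> real"
    using that
  proof (induction k arbitrary: g)
    case 0
    then show ?case
      by (simp add: continuous_on_segment_average smooth_fun_continuous)
  next
    case (Suc k)
    show ?case
    proof (rule k_times_cont_differentiable_SucI)
      show "(segment_average v g has_derivative
          (\<lambda>w. segment_average v (\<lambda>y. frechet_derivative g (at y) w) x)) (at x)" for x
        using Suc.prems unfolding smooth_fun_def by (intro segment_average_has_derivative) blast
      show "k_times_cont_differentiable k
          (\<lambda>x. segment_average v (\<lambda>y. frechet_derivative g (at y) w) x)" for w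
        by (rule Suc.IH[OF smooth_fun_frechet_derivative[OF Suc.prems]])
    qed
  qed
  then show ?thesis using assms unfolding smooth_fun_def by blast
qed

text \<open>Jensen's inequality for \<open>t \<mapsto> |t|\<^sup>r\<close>.\<close>

lemma (in prob_space) expectation_powr_le:
  fixes X :: "'a \<Rightarrow> real"
  assumes r: "1 \<le> r" and X: "integrable M X" "integrable M (\<lambda>x. \<bar>X x\<bar> powr r)"
  shows "\<bar>expectation X\<bar> powr r \<le> expectation (\<lambda>x. \<bar>X x\<bar> powr r)"
proof -
  define m where "m = expectation (\<lambda>x. \<bar>X x\<bar>)"
  have "m \<ge> 0" unfolding m_def by simp
  have le: "\<bar>expectation X\<bar> \<le> m"
    unfolding m_def by (rule integral_abs_bound)
  have "m powr r \<le> expectation (\<lambda>x. \<bar>X x\<bar> powr r)"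
  proof (cases "r = 1 \<or> m = 0")
    case True
    then show ?thesis using \<open>m \<ge> 0\<close> by (auto simp: m_def)
  next
    case False
    define s where "s = r / (r - 1)"
    have r1: "r > 1" and m: "m > 0" using False r \<open>m \<ge> 0\<close> by auto
    have s: "s > 1" "1 / r + 1 / s = 1" "(r - 1) * s = r"
      using r1 by (auto simp: s_def field_simps)
    \<comment> \<open>Young's inequality gives the tangent bound of \<open>t\<^sup>r\<close> at \<open>m\<close>, which is integrated.\<close>
    have "\<bar>X x\<bar> * m powr (r - 1) \<le> \<bar>X x\<bar> powr r / r + m powr r / s" for x
      using Youngs_inequality[of r s "\<bar>X x\<bar>" "m powr (r - 1)"] r1 s
      by (simp add: powr_powr)
    then have "expectation (\<lambda>x. \<bar>X x\<bar> * m powr (r - 1))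
        \<le> expectation (\<lambda>x. \<bar>X x\<bar> powr r / r + m powr r / s)"
      using X by (intro integral_mono) auto
    also have "\<dots> = expectation (\<lambda>x. \<bar>X x\<bar> powr r) / r + m powr r / s"
      using X by (simp add: prob_space)
    also have "expectation (\<lambda>x. \<bar>X x\<bar> * m powr (r - 1)) = m * m powr (r - 1)"
      by (simp add: m_def)
    also have "m * m powr (r - 1) = m powr r"
      using m by (simp add: powr_diff)
    finally have "m powr r * (1 - 1 / s) \<le> expectation (\<lambda>x. \<bar>X x\<bar> powr r) / r"
      by (simp add: right_diff_distrib)
    moreover have "1 - 1 / s = 1 / r" using s(2) by linarith
    ultimately show ?thesis using r1 by (simp add: divide_le_cancel)
  qed
  then show ?thesis
    using powr_mono2[OF _ _ le, of r] r by auto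
qed

lemma continuous_AE_bound:
  fixes g :: "'a::euclidean_space \<Rightarrow> real"
  assumes cont: "continuous_on UNIV g" and AE: "AE x in lborel. \<bar>g x\<bar> \<le> c"
  shows "\<bar>g x\<bar> \<le> c"
proof (rule ccontr)
  assume x: "\<not> \<bar>g x\<bar> \<le> c"
  let ?S = "{x. c < \<bar>g x\<bar>}"
  have "open ?S"
    using cont by (intro open_Collect_less continuous_intros)
  moreover have "x \<in> ?S" using x by simp
  ultimately have "\<not> negligible ?S" using open_not_negligible by blast
  moreover have "AE x in lborel. x \<notin> ?S" using AE by eventually_elim simp
  then have "AE x in lebesgue. x \<notin> ?S" by (simp add: AE_completion_iff)
  then have "?S \<in> null_sets lebesgue"
    using AE_iff_null_sets[of ?S lebesgue] borel_open[OF \<open>open ?S\<close>] by simp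
  ultimately show False by (simp add: negligible_iff_null_sets)
qed

lemma Lp_norm_segment_average_le:
  fixes g :: "'a::euclidean_space \<Rightarrow> real"
  assumes q: "1 \<le> q" and c: "0 \<le> c" and cont: "continuous_on UNIV g"
    and le: "Lp_norm q g \<le> ereal c"
  shows "Lp_norm q (segment_average v g) \<le> ereal c"
proof -
  have [measurable]: "g \<in> borel_measurable borel"
    using cont by (rule borel_measurable_continuous_onI)
  have [measurable]: "segment_average v g \<in> borel_measurable borel"
    using continuous_on_segment_average[OF cont] by (rule borel_measurable_continuous_onI)
  note line = continuous_on_line[OF cont]
  show ?thesis
    using q
  proof (cases rule: exponent_cases)
    case 1
    have "AE x in lborel. \<bar>g x\<bar> \<le> c"
      using le 1 by (simp add: Lp_norm_infinity_le_iff_borel)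
    then have bd: "\<bar>g x\<bar> \<le> c" for x by (rule continuous_AE_bound[OF cont])
    have "\<bar>segment_average v g x\<bar> \<le> c" for x
    proof -
      have "norm (integral (cbox 0 1) (\<lambda>r::real. g (x + r *\<^sub>R v))) \<le> c * measure lborel (cbox 0 (1::real))"
        by (rule has_integral_bound[OF c integrable_integral])
          (use bd line in \<open>auto intro: integrable_continuous_interval\<close>)
      then show ?thesis by (simp add: segment_average_def)
    qed
    then show ?thesis unfolding 1 by (simp add: Lp_norm_infinity_le_iff_borel)
  next
    case (2 r)
    have contr: "continuous_on UNIV (\<lambda>s. \<bar>g (x + s *\<^sub>R v)\<bar> powr r)" for x
      using 2 by (intro continuous_on_powr' continuous_intros line) auto
    have pt: "ennreal (\<bar>segment_average v g x\<bar> powr r)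
        \<le> (\<integral>\<^sup>+s. ennreal (\<bar>g (x + s *\<^sub>R v)\<bar> powr r) \<partial>unit_uniform)" for x
    proof -
      have "\<bar>segment_average v g x\<bar> powr r
          \<le> (LINT s|unit_uniform. \<bar>g (x + s *\<^sub>R v)\<bar> powr r)"
        unfolding segment_average_eq[OF cont]
        by (rule unit_uniform.expectation_powr_le) (use 2 line contr unit_uniform_integral in auto)
      also have "ennreal \<dots> = (\<integral>\<^sup>+s. ennreal (\<bar>g (x + s *\<^sub>R v)\<bar> powr r) \<partial>unit_uniform)"
        by (rule nn_integral_eq_integral[symmetric]) (auto intro: unit_uniform_integral contr)
      finally show ?thesis by (simp add: ennreal_leI)
    qed
    have "(\<integral>\<^sup>+x. ennreal (\<bar>segment_average v g x\<bar> powr r) \<partial>lborel)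
        \<le> (\<integral>\<^sup>+x. \<integral>\<^sup>+s. ennreal (\<bar>g (x + s *\<^sub>R v)\<bar> powr r) \<partial>unit_uniform \<partial>lborel)"
      by (rule nn_integral_mono) (rule pt)
    also have "\<dots> = (\<integral>\<^sup>+s. \<integral>\<^sup>+x. ennreal (\<bar>g (x + s *\<^sub>R v)\<bar> powr r) \<partial>lborel \<partial>unit_uniform)"
      by (rule unit_lborel.Fubini') measurable
    also have "\<dots> = (\<integral>\<^sup>+s. \<integral>\<^sup>+x. ennreal (\<bar>g x\<bar> powr r) \<partial>lborel \<partial>unit_uniform)"
      by (subst nn_integral_lborel_shift[of "\<lambda>x. ennreal (\<bar>g x\<bar> powr r)"]) auto
    also have "\<dots> = (\<integral>\<^sup>+x. ennreal (\<bar>g x\<bar> powr r) \<partial>lborel)"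
      using unit_uniform.emeasure_space_1 by simp
    also have "\<dots> \<le> ennreal (c powr r)"
      using le 2 c by (simp add: Lp_norm_le_iff)
    finally show ?thesis using 2 c by (simp add: Lp_norm_le_iff)
  qed
qed

text \<open>Fubini's theorem for a continuous, compactly supported \<open>g\<close> against a locally integrable \<open>u\<close>: pairing
with an average of \<open>g\<close> is averaging the pairings with the translates of \<open>g\<close>.\<close>

lemma segment_average_integral_swap:
  fixes g u :: "'a::euclidean_space \<Rightarrow> real"
  assumes cont: "continuous_on UNIV g" and supp: "\<And>x. norm x > R \<Longrightarrow> g x = 0"
    and u: "loc_integrable u"
  shows "(LINT x|lborel. segment_average v g x * u x)
      = (LINT r|unit_uniform. LINT x|lborel. g (x + r *\<^sub>R v) * u x)" (is ?eq)
    and "integrable unit_uniform (\<lambda>r. LINT x|lborel. g (x + r *\<^sub>R v) * u x)" (is ?int)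
proof -
  have [measurable]: "g \<in> borel_measurable borel"
    using cont by (rule borel_measurable_continuous_onI)
  have [measurable]: "u \<in> borel_measurable borel" using u by (rule loc_integrable_measurable)
  have "bounded (g ` cball 0 R)"
    using cont by (intro compact_imp_bounded compact_continuous_image) (auto intro: continuous_on_subset)
  then obtain M where M: "M > 0" "\<And>x. x \<in> cball 0 R \<Longrightarrow> \<bar>g x\<bar> \<le> M"
    by (auto simp: bounded_pos)
  have M': "\<bar>g x\<bar> \<le> M" for x
    using M supp[of x] by (cases "norm x > R") auto
  define B where "B x = M * (indicator (cball 0 (R + norm v)) x * \<bar>u x\<bar>)" for x
  have [measurable]: "B \<in> borel_measurable borel" unfolding B_def by measurable
  have intB: "integrable lborel B"
  proof -
    have "integrable lborel (\<lambda>x. \<bar>indicator (cball 0 (R + norm v)) x * u x\<bar>)"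
      using u unfolding loc_integrable_def by (intro integrable_abs) auto
    then show ?thesis unfolding B_def by (simp add: abs_mult)
  qed
  have intB2: "integrable (unit_uniform \<Otimes>\<^sub>M lborel) (\<lambda>(r, x). B x)"
    by (rule unit_lborel.Fubini_integrable)
      (use intB in \<open>auto simp: unit_uniform.prob_space\<close>)
  have bound: "\<bar>g (x + r *\<^sub>R v) * u x\<bar> \<le> B x" if "r \<in> {0..1}" for r x
  proof (cases "norm x > R + norm v")
    case True
    have "norm (r *\<^sub>R v) \<le> norm v" using that by (simp add: mult_left_le_one_le)
    then have "R < norm (x + r *\<^sub>R v)"
      using norm_diff_ineq[of x "r *\<^sub>R v"] True by linarith
    then show ?thesis using supp M(1) by (simp add: B_def)
  next
    case False
    then show ?thesis
      using M'[of "x + r *\<^sub>R v"] by (simp add: B_def abs_mult mult_right_mono)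
  qed
  have AE: "AE z in unit_uniform \<Otimes>\<^sub>M (lborel :: 'a measure). fst z \<in> {0..1}"
  proof (rule unit_lborel.AE_pair_measure)
    show "{z \<in> space (unit_uniform \<Otimes>\<^sub>M (lborel :: 'a measure)). fst z \<in> {0..1}}
        \<in> sets (unit_uniform \<Otimes>\<^sub>M (lborel :: 'a measure))"
      by measurable
  qed (use AE_unit_uniform in auto)
  have int: "integrable (unit_uniform \<Otimes>\<^sub>M lborel) (\<lambda>(r, x). g (x + r *\<^sub>R v) * u x)"
  proof (rule Bochner_Integration.integrable_bound[OF intB2])
    show "(\<lambda>(r, x). g (x + r *\<^sub>R v) * u x) \<in> borel_measurable (unit_uniform \<Otimes>\<^sub>M lborel)"
      by measurable
    show "AE z in unit_uniform \<Otimes>\<^sub>M lborel.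
        norm (case z of (r, x) \<Rightarrow> g (x + r *\<^sub>R v) * u x) \<le> norm (case z of (r, x) \<Rightarrow> B x)"
      using AE by eventually_elim (auto simp: split_beta intro: order_trans[OF bound abs_ge_self])
  qed
  have "(LINT x|lborel. segment_average v g x * u x)
      = (LINT x|lborel. LINT r|unit_uniform. g (x + r *\<^sub>R v) * u x)"
    by (simp add: segment_average_eq[OF cont])
  also have "\<dots> = (LINT r|unit_uniform. LINT x|lborel. g (x + r *\<^sub>R v) * u x)"
    by (rule unit_lborel.Fubini_integral) (rule int)
  finally show ?eq .
  show ?int
    using unit_lborel.integrable_fst'[OF int] by simp
qed

section \<open>Duality with smooth test functions\<close>

text \<open>Every bounded Borel function with bounded support is an almost everywhere limit of uniformly bounded
smooth functions with supports in a common ball. No mollification is needed: \<open>g\<close> is divided by a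
bump that is bounded below on its support, the quotient is approximated by continuous functions and
these, uniformly on a ball, by polynomials; multiplying by the bump restores the compact support.\<close>

lemma smooth_approximation:
  fixes g :: "'a::euclidean_space \<Rightarrow> real"
  assumes [measurable]: "g \<in> borel_measurable borel" and M: "\<And>x. \<bar>g x\<bar> \<le> M"
    and R: "0 \<le> R" and supp: "\<And>x. norm x > R \<Longrightarrow> g x = 0"
  obtains h :: "nat \<Rightarrow> 'a \<Rightarrow> real" and K where "\<And>k. h k \<in> C0_infinity"
    and "\<And>k x. \<bar>h k x\<bar> \<le> K" and "\<And>k x. norm x > R + 1 \<Longrightarrow> h k x = 0"
    and "AE x in lborel. (\<lambda>k. h k x) \<longlonglongrightarrow> g x"
proof -
  define \<rho> where "\<rho> = (bump (R + 1) :: 'a \<Rightarrow> real)"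
  have [measurable]: "\<rho> \<in> borel_measurable borel"
    unfolding \<rho>_def using smooth_fun_continuous[OF smooth_fun_bump]
    by (intro borel_measurable_continuous_onI)
  define G where "G x = g x / \<rho> x" for x
  define L where "L = M * exp 1"
  have [measurable]: "G \<in> borel_measurable borel" unfolding G_def by measurable
  have "M \<ge> 0" using M[of 0] by linarith
  have GL: "\<bar>G x\<bar> \<le> L" for x
  proof (cases "norm x > R")
    case False
    then have lb: "exp (- 1) \<le> \<rho> x" using R by (simp add: \<rho>_def bump_lower_bound)
    have "\<rho> x > 0" using lb exp_gt_zero[of "-1::real"] by linarith
    then have "\<bar>G x\<bar> = \<bar>g x\<bar> / \<rho> x" by (simp add: G_def)
    also have "\<dots> \<le> M / exp (- 1)"
      using lb M \<open>M \<ge> 0\<close> by (intro frac_le) auto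
    finally show ?thesis by (simp add: L_def exp_minus field_simps)
  qed (use \<open>M \<ge> 0\<close> supp in \<open>simp add: G_def L_def\<close>)
  have \<rho>G: "\<rho> x * G x = g x" for x
  proof (cases "norm x > R")
    case False
    then have "exp (- 1) \<le> \<rho> x" using R by (simp add: \<rho>_def bump_lower_bound)
    then have "\<rho> x \<noteq> 0" using exp_gt_zero[of "-1::real"] by linarith
    then show ?thesis by (simp add: G_def)
  qed (simp add: G_def supp)
  have "G measurable_on UNIV"
    by (rule lebesgue_measurable_imp_measurable_on) (auto intro: borel_measurable_lebesgueI)
  then obtain N F where N: "negligible N" and F: "\<And>n. continuous_on UNIV (F n)"
    and lim: "\<And>x. x \<notin> N \<Longrightarrow> (\<lambda>n. F n x) \<longlonglongrightarrow> G x"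
    unfolding measurable_on_def by auto
  define F' where "F' n x = max (- L) (min L (F n x))" for n :: nat and x
  have "\<exists>P. real_polynomial_function P \<and> (\<forall>x\<in>cball 0 (R + 1). \<bar>F' n x - P x\<bar> < 1 / (1 + real n))" for n
  proof -
    have "continuous_on (cball 0 (R + 1)) (F' n)"
      unfolding F'_def using F by (auto intro!: continuous_intros intro: continuous_on_subset)
    then show ?thesis
      using Stone_Weierstrass_real_polynomial_function[of "cball 0 (R + 1)" "F' n" "1 / (1 + real n)"]
      by (metis compact_cball of_nat_0_le_iff zero_less_divide_1_iff add_pos_nonneg zero_less_one)
  qed
  then obtain P where P: "\<And>n. real_polynomial_function (P n)"
    and PF: "\<And>n x. x \<in> cball 0 (R + 1) \<Longrightarrow> \<bar>F' n x - P n x\<bar> < 1 / (1 + real n)"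
    by metis
  define h where "h n x = \<rho> x * P n x" for n x
  have \<rho>0: "\<rho> x = 0" if "norm x > R + 1" for x
    using that R by (simp add: \<rho>_def bump_eq_0)
  show thesis
  proof (rule that[of h "L + 1"])
    fix n
    have "smooth_fun (h n)"
      unfolding h_def \<rho>_def
      by (intro smooth_fun_mult smooth_fun_bump smooth_fun_real_polynomial_function P)
    then show "h n \<in> C0_infinity"
      unfolding C0_infinity_iff using \<rho>0 by (auto simp: h_def)
  next
    fix n x
    have "L \<ge> 0" using \<open>M \<ge> 0\<close> by (simp add: L_def)
    show "\<bar>h n x\<bar> \<le> L + 1"
    proof (cases "norm x > R + 1")
      case False
      have "\<bar>F' n x - P n x\<bar> < 1 / (1 + real n)" using PF False by simp
      also have "\<dots> \<le> 1" by simp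
      finally have "\<bar>F' n x - P n x\<bar> < 1" .
      moreover have "\<bar>F' n x\<bar> \<le> L" using \<open>L \<ge> 0\<close> by (simp add: F'_def)
      ultimately have "\<bar>P n x\<bar> \<le> L + 1" by linarith
      then have "\<bar>\<rho> x\<bar> * \<bar>P n x\<bar> \<le> 1 * (L + 1)"
        by (intro mult_mono) (auto simp: \<rho>_def bump_bounds)
      then show ?thesis by (simp add: h_def abs_mult)
    qed (use \<open>L \<ge> 0\<close> \<rho>0 in \<open>simp add: h_def\<close>)
  next
    show "h n x = 0" if "norm x > R + 1" for n x
      using \<rho>0[OF that] by (simp add: h_def)
  next
    have conv: "(\<lambda>n. h n x) \<longlonglongrightarrow> g x" if x: "x \<notin> N" for x
    proof (cases "norm x > R + 1")
      case True
      then show ?thesis using supp[of x] \<rho>0[of x] by (simp add: h_def)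
    next
      case False
      have "(\<lambda>n. F' n x) \<longlonglongrightarrow> max (- L) (min L (G x))"
        unfolding F'_def by (intro tendsto_intros lim x)
      also have "max (- L) (min L (G x)) = G x" using GL[of x] by auto
      finally have 1: "(\<lambda>n. F' n x) \<longlonglongrightarrow> G x" .
      have "(\<lambda>n. F' n x - P n x) \<longlonglongrightarrow> 0"
      proof (rule Lim_null_comparison)
        show "(\<lambda>n. 1 / (1 + real n)) \<longlonglongrightarrow> 0"
          using LIMSEQ_inverse_real_of_nat by (simp add: inverse_eq_divide add.commute)
        show "\<forall>\<^sub>F n in sequentially. norm (F' n x - P n x) \<le> 1 / (1 + real n)"
          using PF[of x] False by (intro always_eventually) (simp add: less_imp_le)
      qed
      from tendsto_diff[OF 1 this] have "(\<lambda>n. P n x) \<longlonglongrightarrow> G x" by simp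
      then have "(\<lambda>n. h n x) \<longlonglongrightarrow> \<rho> x * G x" unfolding h_def by (intro tendsto_intros)
      then show ?thesis by (simp add: \<rho>G)
    qed
    have "AE x in lebesgue. x \<notin> N"
      using N by (intro AE_not_in) (simp add: negligible_iff_null_sets)
    then have "AE x in lborel. x \<notin> N" by (simp add: AE_completion_iff)
    then show "AE x in lborel. (\<lambda>n. h n x) \<longlonglongrightarrow> g x"
      by eventually_elim (rule conv)
  qed
qed

lemma loc_integrable_const: "loc_integrable (\<lambda>x::'a::euclidean_space. c)"
proof -
  have "emeasure lborel (cball (0::'a) R) < \<infinity>" for R
    by (rule emeasure_lborel_cball_finite)
  then show ?thesis
    unfolding loc_integrable_def by (auto intro!: integrable_mult_left integrable_real_indicator)
qed

lemma C0_infinity_measurable: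
  fixes g :: "'a::euclidean_space \<Rightarrow> real"
  shows "g \<in> C0_infinity \<Longrightarrow> g \<in> borel_measurable borel"
  by (auto simp: C0_infinity_iff intro!: borel_measurable_continuous_onI smooth_fun_continuous)

lemma C0_infinity_cmult:
  fixes g :: "'a::euclidean_space \<Rightarrow> real"
  assumes "g \<in> C0_infinity"
  shows "(\<lambda>x. c * g x) \<in> C0_infinity"
  using assms smooth_fun_linear_image[OF _ bounded_linear_mult_right[of c]]
  unfolding C0_infinity_iff by fastforce

lemma bounded_convergence_integral:
  fixes h :: "nat \<Rightarrow> 'a::euclidean_space \<Rightarrow> real"
  assumes [measurable]: "\<And>k. h k \<in> borel_measurable borel" "g \<in> borel_measurable borel"
    and u: "loc_integrable u"
    and K: "\<And>k x. \<bar>h k x\<bar> \<le> K" and supp: "\<And>k x. norm x > R \<Longrightarrow> h k x = 0"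
    and lim: "AE x in lborel. (\<lambda>k. h k x) \<longlonglongrightarrow> g x"
  shows "(\<lambda>k. LINT x|lborel. h k x * u x) \<longlonglongrightarrow> (LINT x|lborel. g x * u x)"
proof (rule integral_dominated_convergence)
  have [measurable]: "u \<in> borel_measurable borel" using u by (rule loc_integrable_measurable)
  show "(\<lambda>x. g x * u x) \<in> borel_measurable lborel" by measurable
  show "(\<lambda>x. h k x * u x) \<in> borel_measurable lborel" for k by measurable
  show "integrable lborel (\<lambda>x. \<bar>K * indicator (cball 0 R) x * u x\<bar>)"
    using u unfolding loc_integrable_def mult.assoc by (intro integrable_abs integrable_mult_right) auto
  show "AE x in lborel. (\<lambda>k. h k x * u x) \<longlonglongrightarrow> g x * u x"
    using lim by eventually_elim (intro tendsto_intros)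
  have "K \<ge> 0" using K[of 0 0] by linarith
  then have "norm (h k x * u x) \<le> \<bar>K * indicator (cball 0 R) x * u x\<bar>" for k x
    using K[of k x] supp[of x k]
    by (cases "norm x > R") (auto simp: abs_mult indicator_def intro!: mult_right_mono)
  then show "AE x in lborel. norm (h k x * u x) \<le> \<bar>K * indicator (cball 0 R) x * u x\<bar>" for k
    by simp
qed

text \<open>For a finite exponent \<open>s\<close>, a bound on the pairing of \<open>u\<close> with smooth test functions extends to
bounded Borel functions with bounded support, because the \<open>L\<^sup>s\<close>-norms of the approximations converge.
The strict inequality in the last hypothesis leaves room for passing to the limit.\<close>

lemma dual_bound_bounded_functions:
  fixes u g :: "'a::euclidean_space \<Rightarrow> real"
  assumes u: "loc_integrable u" and s: "1 \<le> s"
    and H: "\<And>g. g \<in> C0_infinity \<Longrightarrow> Lp_norm (ereal s) g \<le> 1 \<Longrightarrow> (LINT x|lborel. g x * u x) \<le> b"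
    and [measurable]: "g \<in> borel_measurable borel" and M: "\<And>x. \<bar>g x\<bar> \<le> M"
    and supp: "\<And>x. norm x > R \<Longrightarrow> g x = 0" and R: "0 \<le> R"
    and c: "0 < c" "(LINT x|lborel. \<bar>g x\<bar> powr s) < c powr s"
  shows "(LINT x|lborel. g x * u x) \<le> b * c"
proof -
  obtain h K where h: "\<And>k. h k \<in> C0_infinity" and K: "\<And>k x. \<bar>h k x\<bar> \<le> K"
    and hs: "\<And>k x. norm x > R + 1 \<Longrightarrow> h k x = 0"
    and lim: "AE x in lborel. (\<lambda>k. h k x) \<longlonglongrightarrow> g x"
    using smooth_approximation[of g M R] M supp R by auto
  have [measurable]: "h k \<in> borel_measurable borel" for k by (rule C0_infinity_measurable[OF h])
  have Kp: "\<bar>\<bar>h k x\<bar> powr s\<bar> \<le> K powr s" for k x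
    using K s by (simp add: powr_mono2)
  have "(\<lambda>k. LINT x|lborel. \<bar>h k x\<bar> powr s * 1) \<longlonglongrightarrow> (LINT x|lborel. \<bar>g x\<bar> powr s * 1)"
  proof (rule bounded_convergence_integral[OF _ _ loc_integrable_const Kp, where R = "R + 1"])
    show "AE x in lborel. (\<lambda>k. \<bar>h k x\<bar> powr s) \<longlonglongrightarrow> \<bar>g x\<bar> powr s"
      using lim by eventually_elim (use s in \<open>auto intro!: tendsto_intros tendsto_powr'\<close>)
  qed (use hs in auto)
  then have "(\<lambda>k. LINT x|lborel. \<bar>h k x\<bar> powr s) \<longlonglongrightarrow> (LINT x|lborel. \<bar>g x\<bar> powr s)" by simp
  then have ev: "\<forall>\<^sub>F k in sequentially. (LINT x|lborel. \<bar>h k x\<bar> powr s) < c powr s"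
    using c(2) by (rule order_tendstoD)
  have "(LINT x|lborel. h k x * u x) \<le> b * c" if k: "(LINT x|lborel. \<bar>h k x\<bar> powr s) < c powr s" for k
  proof -
    have mem: "(\<lambda>x. h k x / c) \<in> C0_infinity"
      using C0_infinity_cmult[OF h, of "1 / c"] by simp
    have int: "integrable lborel (\<lambda>x. \<bar>h k x\<bar> powr s)"
      using loc_integrable_mult[OF loc_integrable_const[of 1],
          of "\<lambda>x. \<bar>h k x\<bar> powr s" "K powr s" "R + 1"] hs Kp by simp
    have "(\<integral>\<^sup>+x. ennreal (\<bar>h k x / c\<bar> powr s) \<partial>lborel)
        = (\<integral>\<^sup>+x. ennreal (\<bar>h k x\<bar> powr s / c powr s) \<partial>lborel)"
      using c(1) by (simp add: powr_divide)
    also have "\<dots> = ennreal (LINT x|lborel. \<bar>h k x\<bar> powr s / c powr s)"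
      using int by (intro nn_integral_eq_integral) auto
    also have "\<dots> \<le> ennreal 1"
      using k c by (intro ennreal_leI) (simp add: divide_le_eq)
    finally have "Lp_norm (ereal s) (\<lambda>x. h k x / c) \<le> 1"
      using Lp_norm_le_iff[of s 1 "\<lambda>x. h k x / c"] s by (simp add: one_ereal_def)
    from H[OF mem this] show ?thesis using c by (simp add: divide_le_eq)
  qed
  then have "\<forall>\<^sub>F k in sequentially. (LINT x|lborel. h k x * u x) \<le> b * c"
    by (rule eventually_mono[OF ev])
  moreover have "(\<lambda>k. LINT x|lborel. h k x * u x) \<longlonglongrightarrow> (LINT x|lborel. g x * u x)"
    by (rule bounded_convergence_integral[OF _ _ u K hs lim]) auto
  ultimately show ?thesis
    by (intro tendsto_upperbound) auto
qed

text \<open>Monotone convergence along the sets on which both \<open>x\<close> and \<open>u x\<close> are bounded by \<open>N\<close>.\<close>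

lemma nn_integral_le_exhaustion:
  fixes u :: "'a::euclidean_space \<Rightarrow> real" and F :: "'a \<Rightarrow> real"
  assumes [measurable]: "u \<in> borel_measurable borel" "F \<in> borel_measurable borel"
    and le: "\<And>N::nat. (\<integral>\<^sup>+x. ennreal (if norm x \<le> real N \<and> \<bar>u x\<bar> \<le> real N then F x else 0) \<partial>lborel) \<le> C"
  shows "(\<integral>\<^sup>+x. ennreal (F x) \<partial>lborel) \<le> C"
proof -
  let ?f = "\<lambda>N x. ennreal (if norm x \<le> real N \<and> \<bar>u x\<bar> \<le> real N then F x else 0)"
  have "(\<lambda>N. \<integral>\<^sup>+x. ?f N x \<partial>lborel) \<longlonglongrightarrow> (\<integral>\<^sup>+x. ennreal (F x) \<partial>lborel)"
  proof (rule nn_integral_LIMSEQ)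
    show "incseq ?f"
      by (auto simp: incseq_def le_fun_def)
    show "?f N \<in> borel_measurable lborel" for N by measurable
    fix x
    obtain N0 where N0: "max (norm x) \<bar>u x\<bar> \<le> real N0" using real_arch_simple by blast
    have "\<forall>\<^sub>F N in sequentially. ?f N x = ennreal (F x)"
      using eventually_ge_at_top[of N0]
    proof eventually_elim
      case (elim N)
      then have "real N0 \<le> real N" by simp
      then show ?case using N0 by auto
    qed
    then show "(\<lambda>N. ?f N x) \<longlonglongrightarrow> ennreal (F x)" by (rule tendsto_eventually)
  qed
  then show ?thesis
    by (rule LIMSEQ_le_const2) (use le in auto)
qed

text \<open>Smooth compactly supported test functions determine the \<open>L\<^sup>p\<close>-norm, also for \<open>p = 1\<close> and \<open>p = \<infinity>\<close>.
The extremal functions are truncated to the sets on which \<open>x\<close> and \<open>u x\<close> are bounded. They are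
\<open>sgn u\<close> for \<open>p = 1\<close>, the function \<open>sgn u\<close> cut down to \<open>{|u| > b'}\<close> with \<open>b' > b\<close> for \<open>p = \<infinity>\<close>, and
\<open>sgn u |u|\<^sup>r\<^sup>-\<^sup>1\<close> for \<open>p = r\<close> in between.\<close>

lemma Lp_norm_le_by_duality:
  fixes u :: "'a::euclidean_space \<Rightarrow> real"
  assumes p: "1 \<le> p" and u: "loc_integrable u" and b: "0 \<le> b"
    and H: "\<And>g. g \<in> C0_infinity \<Longrightarrow> Lp_norm (dual_exponent p) g \<le> 1 \<Longrightarrow>
      (LINT x|lborel. g x * u x) \<le> b"
  shows "Lp_norm p u \<le> ereal b"
proof -
  have [measurable]: "u \<in> borel_measurable borel" using u by (rule loc_integrable_measurable)
  define E where "E N x \<longleftrightarrow> norm x \<le> real N \<and> \<bar>u x\<bar> \<le> real N" for N :: nat and x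
  have E_supp: "\<not> E N x" if "norm x > real N" for N x using that by (simp add: E_def)
  have [measurable]: "Measurable.pred borel (E N)" for N unfolding E_def by measurable
  note int1 = loc_integrable_mult[OF loc_integrable_const[of 1], simplified]
  show ?thesis
    using p
  proof (cases rule: dual_exponent_cases)
    case 1
    have "(\<integral>\<^sup>+x. ennreal (if E N x then \<bar>u x\<bar> else 0) \<partial>lborel) \<le> ennreal b" for N
    proof -
      define g where "g x = (if E N x then sgn (u x) else 0)" for x
      have [measurable]: "g \<in> borel_measurable borel" unfolding g_def by measurable
      have g1: "\<bar>g x\<bar> \<le> 1" for x by (simp add: g_def abs_sgn_eq)
      have gs: "g x = 0" if "norm x > real N" for x using E_supp[OF that] by (simp add: g_def)
      obtain h K where h: "\<And>k. h k \<in> C0_infinity" and K: "\<And>k x. \<bar>h k x\<bar> \<le> K"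
        and hs: "\<And>k x. norm x > real N + 1 \<Longrightarrow> h k x = 0"
        and lim: "AE x in lborel. (\<lambda>k. h k x) \<longlonglongrightarrow> g x"
        using smooth_approximation[of g 1 "real N"] g1 gs by auto
      \<comment> \<open>For the dual exponent \<open>\<infinity>\<close> the approximations must be truncated, not rescaled.\<close>
      define w where "w k x = sin (h k x * pi / 2)" for k x
      have w: "w k \<in> C0_infinity" for k
        using h[of k] hs unfolding C0_infinity_iff w_def
        by (auto intro!: smooth_fun_sin exI[of _ "real N + 1"])
      have [measurable]: "w k \<in> borel_measurable borel" for k by (rule C0_infinity_measurable[OF w])
      have w1: "\<bar>w k x\<bar> \<le> 1" for k x by (simp add: w_def)
      have ws: "w k x = 0" if "norm x > real N + 1" for k x using hs[OF that] by (simp add: w_def)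
      have wlim: "AE x in lborel. (\<lambda>k. w k x) \<longlonglongrightarrow> g x"
        using lim
      proof eventually_elim
        case (elim x)
        then have "(\<lambda>k. w k x) \<longlonglongrightarrow> sin (g x * pi / 2)"
          unfolding w_def by (intro tendsto_intros) auto
        also have "sin (g x * pi / 2) = g x"
          by (auto simp: g_def sgn_if)
        finally show ?case .
      qed
      have "Lp_norm (dual_exponent p) (w k) \<le> 1" for k
        using 1 w1 by (simp add: Lp_norm_infinity_le_iff_borel one_ereal_def)
      then have "(LINT x|lborel. w k x * u x) \<le> b" for k by (intro H w)
      moreover have "(\<lambda>k. LINT x|lborel. w k x * u x) \<longlonglongrightarrow> (LINT x|lborel. g x * u x)"
        by (rule bounded_convergence_integral[OF _ _ u w1 ws wlim]) auto
      ultimately have le: "(LINT x|lborel. g x * u x) \<le> b"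
        by (intro LIMSEQ_le_const2) auto
      have eq: "g x * u x = (if E N x then \<bar>u x\<bar> else 0)" for x
        by (simp add: g_def abs_sgn mult.commute)
      have "(\<integral>\<^sup>+x. ennreal (if E N x then \<bar>u x\<bar> else 0) \<partial>lborel)
          = ennreal (LINT x|lborel. g x * u x)"
        unfolding eq[symmetric]
      proof (rule nn_integral_eq_integral)
        show "integrable lborel (\<lambda>x. g x * u x)"
          by (rule loc_integrable_mult[OF u _ g1 gs]) auto
      qed (simp add: eq)
      then show ?thesis using le by (simp add: ennreal_leI)
    qed
    then have "(\<integral>\<^sup>+x. ennreal \<bar>u x\<bar> \<partial>lborel) \<le> ennreal b"
      unfolding E_def by (rule nn_integral_le_exhaustion[of u, rotated 2]) simp_all
    then show ?thesis
      using 1 b Lp_norm_le_iff[of 1 b u] by (simp add: one_ereal_def)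
  next
    case 2
    have "AE x in lborel. \<bar>u x\<bar> \<le> b'" if b': "b < b'" for b'
    proof -
      have "(\<integral>\<^sup>+x. ennreal (if E N x then indicator {x. b' < \<bar>u x\<bar>} x else 0) \<partial>lborel) \<le> 0" for N
      proof -
        define g where "g x = (if E N x then sgn (u x) * indicator {x. b' < \<bar>u x\<bar>} x else 0)" for x
        define v where "v x = (if E N x then indicator {x. b' < \<bar>u x\<bar>} x else 0 :: real)" for x
        have [measurable]: "g \<in> borel_measurable borel" "v \<in> borel_measurable borel"
          unfolding g_def v_def by measurable
        have g1: "\<bar>g x\<bar> \<le> 1" for x by (simp add: g_def abs_sgn_eq abs_mult indicator_def)
        have gs: "g x = 0" "v x = 0" if "norm x > real N" for x
          using E_supp[OF that] by (simp_all add: g_def v_def)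
        have v1: "\<bar>v x\<bar> \<le> 1" for x by (simp add: v_def indicator_def)
        have gv: "\<bar>g x\<bar> = v x" for x
          using b b' by (auto simp: g_def v_def abs_mult abs_sgn_eq indicator_def)
        have int_v: "integrable lborel v" by (rule int1[OF _ v1 gs(2)]) auto
        define I where "I = (LINT x|lborel. v x)"
        have "I \<ge> 0" unfolding I_def v_def by (intro Bochner_Integration.integral_nonneg) (auto simp: indicator_def)
        have "b' * I \<le> (LINT x|lborel. g x * u x)"
          unfolding I_def integral_mult_right_zero[symmetric]
        proof (rule integral_mono)
          show "integrable lborel (\<lambda>x. g x * u x)"
            by (rule loc_integrable_mult[OF u _ g1 gs(1)]) auto
          show "b' * v x \<le> g x * u x" for x
            by (auto simp: v_def g_def indicator_def abs_sgn[symmetric] mult.commute)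
        qed (use int_v in auto)
        moreover have "(LINT x|lborel. g x * u x) \<le> b * c" if "I < c" for c
        proof (rule dual_bound_bounded_functions[OF u order_refl _ _ g1 gs(1)])
          show "0 < c" using that \<open>I \<ge> 0\<close> by simp
          then show "(LINT x|lborel. \<bar>g x\<bar> powr 1) < c powr 1"
            using that by (simp add: gv I_def) (simp flip: gv)
        qed (use H 2 in \<open>auto simp: one_ereal_def\<close>)
        ultimately have bc: "b' * I \<le> b * c" if "I < c" for c using that by force
        have "b' * I \<le> b * I"
        proof (rule field_le_epsilon)
          fix e :: real assume e: "0 < e"
          have "b' * I \<le> b * (I + e / (b + 1))" using b e by (intro bc) simp
          also have "b * (I + e / (b + 1)) \<le> b * I + e"
            using b e by (simp add: field_simps)
          finally show "b' * I \<le> b * I + e" .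
        qed
        then have "I \<le> 0" using b' \<open>I \<ge> 0\<close> by (smt (verit) mult_less_cancel_right)
        moreover have "(\<integral>\<^sup>+x. ennreal (v x) \<partial>lborel) = ennreal I"
          unfolding I_def by (rule nn_integral_eq_integral[OF int_v]) (simp add: v_def indicator_def)
        ultimately have "(\<integral>\<^sup>+x. ennreal (v x) \<partial>lborel) \<le> 0"
          by (simp add: ennreal_neg)
        then show ?thesis unfolding v_def .
      qed
      then have "(\<integral>\<^sup>+x. ennreal (indicator {x. b' < \<bar>u x\<bar>} x) \<partial>lborel) \<le> 0"
        unfolding E_def by (rule nn_integral_le_exhaustion[of u, rotated 2]) simp_all
      then have "AE x in lborel. ennreal (indicator {x. b' < \<bar>u x\<bar>} x) = 0"
        by (subst nn_integral_0_iff_AE[symmetric]) auto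
      then show ?thesis by eventually_elim (auto simp: indicator_def split: if_splits)
    qed
    then have "AE x in lborel. \<forall>n. \<bar>u x\<bar> \<le> b + 1 / real (Suc n)"
      by (subst AE_all_countable) auto
    then have "AE x in lborel. \<bar>u x\<bar> \<le> b"
    proof eventually_elim
      case (elim x)
      have "(\<lambda>n. b + 1 / real (Suc n)) \<longlonglongrightarrow> b + 0"
        by (intro tendsto_intros LIMSEQ_Suc[OF lim_1_over_n])
      then show ?case using elim by (intro LIMSEQ_le_const[of _ b]) auto
    qed
    then show ?thesis using 2 by (simp add: Lp_norm_infinity_le_iff_borel)
  next
    case (3 r s)
    have rs: "(r - 1) * s = r" using 3 by (simp add: field_simps)
    have "(\<integral>\<^sup>+x. ennreal (if E N x then \<bar>u x\<bar> powr r else 0) \<partial>lborel) \<le> ennreal (b powr r)" for N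
    proof -
      define g where "g x = (if E N x then sgn (u x) * \<bar>u x\<bar> powr (r - 1) else 0)" for x
      define v where "v x = (if E N x then \<bar>u x\<bar> powr r else 0)" for x
      have [measurable]: "g \<in> borel_measurable borel" "v \<in> borel_measurable borel"
        unfolding g_def v_def by measurable
      have g1: "\<bar>g x\<bar> \<le> real N powr (r - 1)" for x
        using 3 by (auto simp: g_def E_def abs_mult abs_sgn_eq intro!: powr_mono2)
      have gs: "g x = 0" "v x = 0" if "norm x > real N" for x
        using E_supp[OF that] by (simp_all add: g_def v_def)
      have v1: "\<bar>v x\<bar> \<le> real N powr r" for x
        using 3 by (auto simp: v_def E_def intro!: powr_mono2)
      have int_v: "integrable lborel v" by (rule int1[OF _ v1 gs(2)]) auto
      have gv: "\<bar>g x\<bar> powr s = v x" for x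
        using rs 3 by (auto simp: g_def v_def abs_mult abs_sgn_eq powr_powr)
      have guv: "g x * u x = v x" for x
      proof (cases "u x = 0")
        case False
        have "\<bar>u x\<bar> powr (r - 1) * \<bar>u x\<bar> = \<bar>u x\<bar> powr r"
          using False by (simp add: powr_diff)
        moreover have "sgn (u x) * \<bar>u x\<bar> powr (r - 1) * u x = \<bar>u x\<bar> powr (r - 1) * \<bar>u x\<bar>"
          by (simp add: abs_sgn[of "u x"] mult_ac)
        ultimately show ?thesis by (simp add: g_def v_def)
      qed (simp add: g_def v_def)
      define I where "I = (LINT x|lborel. v x)"
      have "I \<ge> 0" unfolding I_def v_def by (intro Bochner_Integration.integral_nonneg) auto
      have bc: "I \<le> b * c" if "I powr (1 / s) < c" for c
      proof -
        have "(LINT x|lborel. g x * u x) \<le> b * c"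
        proof (rule dual_bound_bounded_functions[OF u _ _ _ g1 gs(1)])
          show "0 < c" using that powr_ge_zero[of I "1 / s"] by linarith
          have "(I powr (1 / s)) powr s < c powr s"
            using that 3 by (intro powr_less_mono2) auto
          then show "(LINT x|lborel. \<bar>g x\<bar> powr s) < c powr s"
            using \<open>I \<ge> 0\<close> 3 by (simp add: gv I_def powr_powr)
        qed (use H 3 in \<open>auto simp: one_ereal_def\<close>)
        then show ?thesis by (simp add: guv I_def)
      qed
      have "I \<le> b powr r"
      proof (cases "I = 0 \<or> b = 0")
        case True
        then show ?thesis using bc[of "I powr (1 / s) + 1"] by auto
      next
        case False
        then have "I > 0" "b > 0" using \<open>I \<ge> 0\<close> b by auto
        have "I / b \<le> I powr (1 / s)"
        proof (rule dense_ge)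
          fix c assume "I powr (1 / s) < c"
          then have "I \<le> b * c" by (rule bc)
          then show "I / b \<le> c" using \<open>b > 0\<close> by (simp add: divide_le_eq mult.commute)
        qed
        then have "I \<le> b * I powr (1 / s)" using \<open>b > 0\<close> by (simp add: divide_le_eq mult.commute)
        then have "I / I powr (1 / s) \<le> b" using \<open>I > 0\<close> by (simp add: divide_le_eq)
        also have "I / I powr (1 / s) = I powr (1 - 1 / s)"
          using \<open>I > 0\<close> by (simp add: powr_diff)
        also have "1 - 1 / s = 1 / r" using 3 by linarith
        finally have "(I powr (1 / r)) powr r \<le> b powr r" using 3 by (intro powr_mono2) auto
        then show ?thesis using 3 \<open>I > 0\<close> by (simp add: powr_powr)
      qed
      moreover have "(\<integral>\<^sup>+x. ennreal (v x) \<partial>lborel) = ennreal I"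
        unfolding I_def by (rule nn_integral_eq_integral[OF int_v]) (simp add: v_def)
      ultimately show ?thesis unfolding v_def by (simp add: ennreal_leI)
    qed
    then have "(\<integral>\<^sup>+x. ennreal (\<bar>u x\<bar> powr r) \<partial>lborel) \<le> ennreal (b powr r)"
      unfolding E_def by (rule nn_integral_le_exhaustion[of u, rotated 2]) simp_all
    then show ?thesis
      using 3 b by (simp add: Lp_norm_le_iff)
  qed
qed

section \<open>Derivatives of smooth functions and continuous test functions\<close>

text \<open>The directional derivative defined through one-dimensional difference quotients agrees, on smooth
functions, with the total derivative.\<close>

lemma directional_derivative_eq:
  fixes \<phi> :: "real ^ 'n \<Rightarrow> real"
  assumes "smooth_fun \<phi>"
  shows "directional_derivative e \<phi> x = frechet_derivative \<phi> (at x) e"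
proof -
  have "linear (frechet_derivative \<phi> (at x))"
    using smooth_fun_has_derivative[OF assms] has_derivative_linear by blast
  then have sc: "frechet_derivative \<phi> (at x) (s *\<^sub>R e) = s * frechet_derivative \<phi> (at x) e" for s
    by (simp add: linear_cmul)
  have "((\<lambda>t. \<phi> (x + t *\<^sub>R e)) has_derivative
      (\<lambda>s. frechet_derivative \<phi> (at (x + 0 *\<^sub>R e)) (s *\<^sub>R e))) (at 0)"
    by (rule has_derivative_compose[OF _ smooth_fun_has_derivative[OF assms]])
      (auto intro!: derivative_eq_intros)
  moreover have "(\<lambda>s. frechet_derivative \<phi> (at (x + 0 *\<^sub>R e)) (s *\<^sub>R e))
      = (*) (frechet_derivative \<phi> (at x) e)"
    by (rule ext) (simp add: sc)
  ultimately have "((\<lambda>t. \<phi> (x + t *\<^sub>R e)) has_field_derivative frechet_derivative \<phi> (at x) e) (at 0)"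
    unfolding has_field_derivative_def by metis
  then show ?thesis
    unfolding directional_derivative_def by (rule DERIV_imp_deriv)
qed

lemma smooth_fun_component:
  fixes \<Phi> :: "real ^ 'n \<Rightarrow> real ^ 'n"
  assumes "smooth_fun \<Phi>"
  shows "smooth_fun (\<lambda>x. \<Phi> x $ i)"
  using smooth_fun_linear_image[OF assms bounded_linear_vec_nth] .

lemma divergence_eq:
  assumes "smooth_fun \<Phi>"
  shows "divergence \<Phi> x = (\<Sum>i\<in>UNIV. frechet_derivative (\<lambda>y. \<Phi> y $ i) (at x) (axis i 1))"
  unfolding divergence_def by (simp add: directional_derivative_eq smooth_fun_component assms)

lemma powr_midpoint_le:
  fixes x y r :: real
  assumes "0 \<le> x" "0 \<le> y" "1 \<le> r"
  shows "((x + y) / 2) powr r \<le> (x powr r + y powr r) / 2"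
proof -
  have half: "(z / 2) powr r \<le> z powr r / 2" if "0 \<le> z" for z :: real
  proof -
    have "(1 / 2) powr r \<le> (1 / 2 :: real) powr 1" using assms(3) by (intro powr_mono') auto
    then have "z powr r * (1 / 2) powr r \<le> z powr r * (1 / 2)" by (intro mult_left_mono) auto
    then show ?thesis using powr_mult[of z "1 / 2" r] that by simp
  qed
  consider "x = 0" | "y = 0" | "x > 0" "y > 0" using assms by linarith
  then show ?thesis
  proof cases
    case 3
    have "(\<lambda>x. x powr r) ((1 - 1 / 2) *\<^sub>R x + (1 / 2) *\<^sub>R y)
        \<le> (1 - 1 / 2) * x powr r + (1 / 2) * y powr r"
      by (rule convex_onD[OF powr_convex[OF assms(3)]]) (use 3 in auto)
    then show ?thesis by (simp add: add_divide_distrib)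
  qed (use half assms in auto)
qed

lemma Lp_norm_half_difference_le:
  fixes g :: "'a::euclidean_space \<Rightarrow> real"
  assumes q: "1 \<le> q" and [measurable]: "g \<in> borel_measurable borel" and g: "Lp_norm q g \<le> 1"
  shows "Lp_norm q (\<lambda>x. (g (x + h) - g x) / 2) \<le> 1"
proof -
  have g1: "Lp_norm q g \<le> ereal 1" using g by (simp add: one_ereal_def)
  note gh = Lp_norm_shift_le[OF q _ _ g1, of h, simplified]
  have "Lp_norm q (\<lambda>x. (g (x + h) - g x) / 2) \<le> ereal 1"
    using q
  proof (cases rule: exponent_cases)
    case 1
    have "AE x in lborel. \<bar>g x\<bar> \<le> 1" "AE x in lborel. \<bar>g (x + h)\<bar> \<le> 1"
      using g1 gh unfolding 1 by (simp_all add: Lp_norm_infinity_le_iff_borel)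
    then have "AE x in lborel. \<bar>(g (x + h) - g x) / 2\<bar> \<le> 1"
    proof eventually_elim
      case (elim x)
      then have "\<bar>g (x + h) - g x\<bar> \<le> 2" by linarith
      then show ?case by simp
    qed
    then show ?thesis unfolding 1 by (simp add: Lp_norm_infinity_le_iff_borel)
  next
    case (2 r)
    have I: "(\<integral>\<^sup>+x. ennreal (\<bar>g x\<bar> powr r) \<partial>lborel) \<le> 1"
      and Ih: "(\<integral>\<^sup>+x. ennreal (\<bar>g (x + h)\<bar> powr r) \<partial>lborel) \<le> 1"
      using g1 gh 2 by (simp_all add: Lp_norm_le_iff)
    have pt: "\<bar>(g (x + h) - g x) / 2\<bar> powr r \<le> (\<bar>g (x + h)\<bar> powr r + \<bar>g x\<bar> powr r) / 2" for x
    proof -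
      have "\<bar>(g (x + h) - g x) / 2\<bar> powr r \<le> ((\<bar>g (x + h)\<bar> + \<bar>g x\<bar>) / 2) powr r"
        using 2 by (intro powr_mono2) auto
      also have "\<dots> \<le> (\<bar>g (x + h)\<bar> powr r + \<bar>g x\<bar> powr r) / 2"
        using 2 by (intro powr_midpoint_le) auto
      finally show ?thesis .
    qed
    have "(\<integral>\<^sup>+x. ennreal (\<bar>(g (x + h) - g x) / 2\<bar> powr r) \<partial>lborel)
        \<le> (\<integral>\<^sup>+x. ennreal (1 / 2) * (ennreal (\<bar>g (x + h)\<bar> powr r) + ennreal (\<bar>g x\<bar> powr r)) \<partial>lborel)"
      using pt by (intro nn_integral_mono)
        (simp del: ennreal_half flip: ennreal_mult ennreal_plus add: ennreal_leI)
    also have "\<dots> = ennreal (1 / 2) * ((\<integral>\<^sup>+x. ennreal (\<bar>g (x + h)\<bar> powr r) \<partial>lborel)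
        + (\<integral>\<^sup>+x. ennreal (\<bar>g x\<bar> powr r) \<partial>lborel))"
      by (simp add: nn_integral_cmult nn_integral_add)
    also have "\<dots> \<le> ennreal (1 / 2) * (1 + 1)"
      using I Ih by (intro mult_left_mono add_mono) auto
    also have "\<dots> = ennreal 1"
    proof -
      have "ennreal (1 / 2) * (1 + 1) = ennreal (1 / 2) * ennreal 2" by simp
      also have "\<dots> = ennreal 1" by (subst ennreal_mult[symmetric]) auto
      finally show ?thesis .
    qed
    finally show ?thesis using 2 by (simp add: Lp_norm_le_iff)
  qed
  then show ?thesis by (simp add: one_ereal_def)
qed

text \<open>Continuous functions with compact support, in the form "zero outside some ball".\<close>

definition cont_comp_supp :: "('a::euclidean_space \<Rightarrow> real) \<Rightarrow> bool" where
  "cont_comp_supp g \<longleftrightarrow> continuous_on UNIV g \<and> (\<exists>R. \<forall>x. norm x > R \<longrightarrow> g x = 0)"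

lemma cont_comp_suppD:
  assumes "cont_comp_supp g"
  shows "continuous_on UNIV g" "g \<in> borel_measurable borel"
  using assms by (auto simp: cont_comp_supp_def intro: borel_measurable_continuous_onI)

lemma C0_infinity_imp_cont_comp_supp:
  fixes g :: "'a::euclidean_space \<Rightarrow> real"
  shows "g \<in> C0_infinity \<Longrightarrow> cont_comp_supp g"
  by (auto simp: C0_infinity_iff cont_comp_supp_def smooth_fun_continuous)

lemma cont_comp_supp_shift:
  assumes "cont_comp_supp g"
  shows "cont_comp_supp (\<lambda>x. g (x + h))"
proof -
  from assms obtain R where c: "continuous_on UNIV g" and R: "\<And>x. norm x > R \<Longrightarrow> g x = 0"
    by (auto simp: cont_comp_supp_def)
  have "g (x + h) = 0" if "norm x > R + norm h" for x
    using R norm_diff_ineq[of x h] that by force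
  moreover have "continuous_on UNIV (\<lambda>x. g (x + h))"
    by (rule continuous_on_compose2[OF c]) (auto intro!: continuous_intros)
  ultimately show ?thesis unfolding cont_comp_supp_def by blast
qed

lemma cont_comp_supp_segment_average:
  assumes "cont_comp_supp g"
  shows "cont_comp_supp (segment_average v g)"
proof -
  from assms obtain R where c: "continuous_on UNIV g" and R: "\<And>x. norm x > R \<Longrightarrow> g x = 0"
    by (auto simp: cont_comp_supp_def)
  have "\<forall>x. norm x > R + norm v \<longrightarrow> segment_average v g x = 0"
    using segment_average_support[where R = R and g = g and v = v] R by blast
  then show ?thesis
    unfolding cont_comp_supp_def using continuous_on_segment_average[OF c] by blast
qed

lemma cont_comp_supp_integrable:
  assumes g: "cont_comp_supp g" and u: "loc_integrable u"
  shows "integrable lborel (\<lambda>x. g x * u x)"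
proof -
  from g obtain R where c: "continuous_on UNIV g" and R: "\<And>x. norm x > R \<Longrightarrow> g x = 0"
    by (auto simp: cont_comp_supp_def)
  have "bounded (g ` cball 0 R)"
    using c by (intro compact_imp_bounded compact_continuous_image) (auto intro: continuous_on_subset)
  then obtain M where M: "M > 0" "\<And>x. x \<in> cball 0 R \<Longrightarrow> \<bar>g x\<bar> \<le> M"
    by (auto simp: bounded_pos)
  have "\<bar>g x\<bar> \<le> M" for x
    using M R[of x] by (cases "norm x > R") auto
  then show ?thesis
    using loc_integrable_mult[OF u cont_comp_suppD(2)[OF g] _ R] by blast
qed

text \<open>A translation of the test function is moved onto \<open>f\<close>.\<close>

lemma integral_difference_shift:
  assumes g: "cont_comp_supp g" and f: "loc_integrable f"
  shows "(LINT x|lborel. g (x + h) * f x) - (LINT x|lborel. g x * f x)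
    = (LINT x|lborel. g x * (f (x - h) - f x))"
proof -
  have [measurable]: "g \<in> borel_measurable borel" "f \<in> borel_measurable borel"
    using cont_comp_suppD(2)[OF g] loc_integrable_measurable[OF f] .
  have fh: "loc_integrable (\<lambda>x. f (x - h))" using loc_integrable_shift[OF f, of "- h"] by simp
  have "(LINT x|lborel. g (x + h) * f x) = (LINT x|lborel. g x * f (x - h))"
    using integral_lborel_shift[of "\<lambda>x. g x * f (x - h)" h] by simp
  then show ?thesis
    using cont_comp_supp_integrable[OF g f] cont_comp_supp_integrable[OF g fh]
    by (simp add: right_diff_distrib)
qed

section \<open>The lower bound for locally integrable functions\<close>

text \<open>By duality it suffices to pair \<open>f(x - h) - f(x)\<close> with a test function \<open>g\<close> of dual norm at most \<open>1\<close>.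
The pairing is that of \<open>f\<close> with \<open>g(x + h) - g(x)\<close>, and for \<open>h = t e\<close> with \<open>|e| = 1\<close> half of this
difference is the derivative in direction \<open>e\<close> of \<open>t/2\<close> times the segment average of \<open>g\<close>. That
function has norm at most \<open>t/2 \<le> \<epsilon>\<close>, and its derivative has norm at most \<open>1\<close>.\<close>

lemma Lp_norm_difference_le_by_directional_derivatives:
  fixes f :: "real ^ 'n \<Rightarrow> real"
  assumes p: "1 \<le> p" and f: "loc_integrable f" and b: "0 \<le> b"
    and H: "\<And>e \<phi>. norm e = 1 \<Longrightarrow> \<phi> \<in> C0_infinity \<Longrightarrow>
      Lp_norm (dual_exponent p) (directional_derivative e \<phi>) \<le> 1 \<Longrightarrow>
      Lp_norm (dual_exponent p) \<phi> \<le> ereal \<epsilon> \<Longrightarrow>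
      (LINT x|lborel. directional_derivative e \<phi> x * f x) \<le> b"
    and h: "norm h \<le> 2 * \<epsilon>"
  shows "Lp_norm p (\<lambda>x. f (x - h) - f x) \<le> ereal (2 * b)"
proof (rule Lp_norm_le_by_duality[OF p])
  have "loc_integrable (\<lambda>x. f (x - h))" using loc_integrable_shift[OF f, of "- h"] by simp
  then show "loc_integrable (\<lambda>x. f (x - h) - f x)" using f by (rule loc_integrable_diff)
  show "0 \<le> 2 * b" using b by simp
  fix g :: "real ^ 'n \<Rightarrow> real"
  assume g: "g \<in> C0_infinity" and g1: "Lp_norm (dual_exponent p) g \<le> 1"
  note q = dual_exponent_ge_1[OF p]
  have sg: "smooth_fun g" using g by (simp add: C0_infinity_iff)
  have cg: "cont_comp_supp g" using g by (rule C0_infinity_imp_cont_comp_supp)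
  have [measurable]: "g \<in> borel_measurable borel" using cont_comp_suppD(2)[OF cg] .
  obtain e :: "real ^ 'n" and t where e: "norm e = 1" and t: "0 \<le> t" "h = t *\<^sub>R e"
  proof (cases "h = 0")
    case True
    show thesis
      by (rule that[of "axis undefined 1" 0]) (use True in \<open>auto simp: norm_axis_1\<close>)
  next
    case False
    then show thesis
      by (intro that[of "(1 / norm h) *\<^sub>R h" "norm h"]) auto
  qed
  have th: "t = norm h" using e t by simp
  define \<phi> where "\<phi> x = (t / 2) * segment_average h g x" for x
  have \<phi>: "\<phi> \<in> C0_infinity"
  proof -
    have "segment_average h g \<in> C0_infinity"
      using smooth_fun_segment_average[OF sg] cont_comp_supp_segment_average[OF cg]
      by (auto simp: C0_infinity_iff cont_comp_supp_def)
    then show ?thesis unfolding \<phi>_def by (rule C0_infinity_cmult)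
  qed
  have dd: "directional_derivative e \<phi> x = (g (x + h) - g x) / 2" for x
  proof -
    have "(segment_average h g has_derivative
        (\<lambda>w. segment_average h (\<lambda>y. frechet_derivative g (at y) w) x)) (at x)"
      using sg unfolding smooth_fun_def by (intro segment_average_has_derivative) blast
    then have "(\<phi> has_derivative
        (\<lambda>w. (t / 2) * segment_average h (\<lambda>y. frechet_derivative g (at y) w) x)) (at x)"
      unfolding \<phi>_def by (rule has_derivative_mult_right)
    then have "frechet_derivative \<phi> (at x) e
        = (t / 2) * segment_average h (\<lambda>y. frechet_derivative g (at y) e) x"
      using frechet_derivative_at by metis
    also have "\<dots> = segment_average h (\<lambda>y. t * frechet_derivative g (at y) e) x / 2"
      by (simp add: segment_average_cmult)
    also have "(\<lambda>y. t * frechet_derivative g (at y) e) = (\<lambda>y. frechet_derivative g (at y) h)"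
    proof
      fix y
      have "linear (frechet_derivative g (at y))"
        using smooth_fun_has_derivative[OF sg] has_derivative_linear by blast
      then show "t * frechet_derivative g (at y) e = frechet_derivative g (at y) h"
        unfolding t(2) by (simp add: linear_cmul)
    qed
    also have "segment_average h (\<lambda>y. frechet_derivative g (at y) h) x = g (x + h) - g x"
      by (rule segment_average_frechet_derivative[OF sg])
    finally show ?thesis
      using \<phi> by (simp add: directional_derivative_eq C0_infinity_iff)
  qed
  have n1: "Lp_norm (dual_exponent p) (directional_derivative e \<phi>) \<le> 1"
    unfolding dd[abs_def] by (rule Lp_norm_half_difference_le[OF q _ g1]) measurable
  have n2: "Lp_norm (dual_exponent p) \<phi> \<le> ereal \<epsilon>"
  proof -
    have tg: "Lp_norm (dual_exponent p) (\<lambda>x. (t / 2) * g x) \<le> ereal (t / 2)"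
      using q
    proof (cases rule: exponent_cases)
      case 1
      have "AE x in lborel. \<bar>g x\<bar> \<le> 1"
        using g1 unfolding 1 by (simp add: Lp_norm_infinity_le_iff_borel one_ereal_def)
      then have "AE x in lborel. \<bar>t / 2 * g x\<bar> \<le> t / 2"
        by eventually_elim (use t in \<open>simp add: abs_mult mult_left_le\<close>)
      then show ?thesis unfolding 1 by (simp add: Lp_norm_infinity_le_iff_borel)
    next
      case (2 r)
      have "\<bar>t / 2 * g x\<bar> = (t / 2) * \<bar>g x\<bar>" for x
        using t by (simp add: abs_mult)
      then have eq: "ennreal (\<bar>t / 2 * g x\<bar> powr r)
          = ennreal ((t / 2) powr r) * ennreal (\<bar>g x\<bar> powr r)" for x
        using t by (simp only: powr_mult) (simp add: powr_mult ennreal_mult)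
      have "(\<integral>\<^sup>+x. ennreal (\<bar>g x\<bar> powr r) \<partial>lborel) \<le> 1"
        using g1 2 by (simp add: Lp_norm_le_iff one_ereal_def)
      then have "ennreal ((t / 2) powr r) * (\<integral>\<^sup>+x. ennreal (\<bar>g x\<bar> powr r) \<partial>lborel)
          \<le> ennreal ((t / 2) powr r) * 1"
        by (intro mult_left_mono) auto
      then have "(\<integral>\<^sup>+x. ennreal (\<bar>t / 2 * g x\<bar> powr r) \<partial>lborel) \<le> ennreal ((t / 2) powr r)"
        unfolding eq by (subst nn_integral_cmult) auto
      then show ?thesis using 2 t by (simp add: Lp_norm_le_iff)
    qed
    have "Lp_norm (dual_exponent p) (segment_average h (\<lambda>x. (t / 2) * g x)) \<le> ereal (t / 2)"
      by (rule Lp_norm_segment_average_le[OF q _ _ tg])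
        (use t cont_comp_suppD(1)[OF cg] in \<open>auto intro!: continuous_intros\<close>)
    also have "segment_average h (\<lambda>x. (t / 2) * g x) = \<phi>"
      by (rule ext) (simp only: segment_average_cmult \<phi>_def)
    also have "ereal (t / 2) \<le> ereal \<epsilon>" using h th by simp
    finally show ?thesis .
  qed
  have "(LINT x|lborel. (g (x + h) - g x) / 2 * f x) \<le> b"
    using H[OF e \<phi> n1 n2] by (simp add: dd)
  moreover have "(LINT x|lborel. (g (x + h) - g x) / 2 * f x)
      = (LINT x|lborel. g (x + h) * f x / 2 - g x * f x / 2)"
    by (simp add: algebra_simps diff_divide_distrib)
  moreover have "\<dots> = ((LINT x|lborel. g (x + h) * f x) - (LINT x|lborel. g x * f x)) / 2"
    using cont_comp_supp_integrable[OF cg f]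
      cont_comp_supp_integrable[OF cont_comp_supp_shift[OF cg] f]
    by (simp add: diff_divide_distrib)
  ultimately show "(LINT x|lborel. g x * (f (x - h) - f x)) \<le> 2 * b"
    by (simp add: integral_difference_shift[OF cg f])
qed

section \<open>The upper bound for locally integrable functions\<close>

text \<open>All translates of \<open>g\<close>, paired with the differences \<open>f(x - k) - f(x)\<close> for \<open>|k| \<le> \<epsilon>\<close>, are bounded by
\<open>c\<close>. Quantifying over the translates \<open>h\<close> makes the property stable under averaging along arbitrary
segments, so that no norms of iterated averages have to be estimated.\<close>

definition difference_bound ::
    "real \<Rightarrow> ('a::euclidean_space \<Rightarrow> real) \<Rightarrow> real \<Rightarrow> ('a \<Rightarrow> real) \<Rightarrow> bool" where
  "difference_bound \<epsilon> f c g \<longleftrightarrow> cont_comp_supp g \<and>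
    (\<forall>h k. norm k \<le> \<epsilon> \<longrightarrow> \<bar>LINT x|lborel. g (x + h) * (f (x - k) - f x)\<bar> \<le> c)"

lemma difference_bound_Holder:
  fixes f g :: "'a::euclidean_space \<Rightarrow> real"
  assumes p: "1 \<le> p" and f: "loc_integrable f" and g: "cont_comp_supp g"
    and ga: "Lp_norm (dual_exponent p) g \<le> ereal a" and a: "0 < a" and w: "0 \<le> w"
    and fw: "\<And>k. norm k \<le> \<epsilon> \<Longrightarrow> Lp_norm p (\<lambda>x. f (x - k) - f x) \<le> ereal w"
  shows "difference_bound \<epsilon> f (a * w) g"
  unfolding difference_bound_def
proof (intro conjI allI impI g)
  fix h k :: 'a assume k: "norm k \<le> \<epsilon>"
  have [measurable]: "g \<in> borel_measurable borel" "f \<in> borel_measurable borel"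
    using cont_comp_suppD(2)[OF g] loc_integrable_measurable[OF f] .
  have "Lp_norm (dual_exponent p) (\<lambda>x. g (x + h)) \<le> ereal a"
    using a by (intro Lp_norm_shift_le dual_exponent_ge_1 p ga) auto
  then show "\<bar>LINT x|lborel. g (x + h) * (f (x - k) - f x)\<bar> \<le> a * w"
    by (intro Lp_Holder_integral[OF p] fw k a w) measurable
qed

lemma unit_uniform_abs_integral_le:
  fixes F :: "real \<Rightarrow> real"
  assumes "integrable unit_uniform F" and "\<And>r. r \<in> {0..1} \<Longrightarrow> \<bar>F r\<bar> \<le> c"
  shows "\<bar>LINT r|unit_uniform. F r\<bar> \<le> c"
proof -
  have "\<bar>LINT r|unit_uniform. F r\<bar> \<le> (LINT r|unit_uniform. \<bar>F r\<bar>)"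
    by (rule integral_abs_bound)
  also have "\<dots> \<le> (LINT r|unit_uniform. c)"
  proof (rule integral_mono_AE)
    show "AE r in unit_uniform. \<bar>F r\<bar> \<le> c"
      using AE_unit_uniform by eventually_elim (rule assms(2))
  qed (use assms(1) in auto)
  also have "\<dots> = c" using unit_uniform.prob_space by simp
  finally show ?thesis .
qed

lemma difference_bound_segment_average:
  fixes f g :: "'a::euclidean_space \<Rightarrow> real"
  assumes f: "loc_integrable f" and g: "difference_bound \<epsilon> f c g"
  shows "difference_bound \<epsilon> f c (segment_average v g)"
  unfolding difference_bound_def
proof (intro conjI allI impI)
  have cg: "cont_comp_supp g" using g by (simp add: difference_bound_def)
  then show "cont_comp_supp (segment_average v g)" by (rule cont_comp_supp_segment_average)
  fix h k :: 'a assume k: "norm k \<le> \<epsilon>"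
  have fk: "loc_integrable (\<lambda>x. f (x - k) - f x)"
    using loc_integrable_shift[OF f, of "- k"] f by (intro loc_integrable_diff) auto
  from cont_comp_supp_shift[OF cg, of h]
  obtain R where c: "continuous_on UNIV (\<lambda>x. g (x + h))"
    and R: "\<And>x. norm x > R \<Longrightarrow> g (x + h) = 0"
    by (auto simp: cont_comp_supp_def)
  note swap = segment_average_integral_swap[OF c R fk, where v = v]
  have "segment_average v g (x + h) = segment_average v (\<lambda>x. g (x + h)) x" for x
    by (simp add: segment_average_def algebra_simps)
  then have "(LINT x|lborel. segment_average v g (x + h) * (f (x - k) - f x))
      = (LINT r|unit_uniform. LINT x|lborel. g (x + r *\<^sub>R v + h) * (f (x - k) - f x))"
    using swap(1) by simp
  moreover have "\<bar>LINT x|lborel. g (x + r *\<^sub>R v + h) * (f (x - k) - f x)\<bar> \<le> c" for r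
    using g k by (simp add: difference_bound_def add.assoc)
  ultimately show "\<bar>LINT x|lborel. segment_average v g (x + h) * (f (x - k) - f x)\<bar> \<le> c"
    using unit_uniform_abs_integral_le[OF swap(2)] by simp
qed

lemma difference_bound_shift:
  assumes f: "loc_integrable f" and g: "difference_bound \<epsilon> f c g" and v: "norm v \<le> \<epsilon>"
  shows "\<bar>(LINT x|lborel. g (x + v) * f x) - (LINT x|lborel. g x * f x)\<bar> \<le> c"
proof -
  have cg: "cont_comp_supp g" using g by (simp add: difference_bound_def)
  have "\<bar>LINT x|lborel. g (x + 0) * (f (x - v) - f x)\<bar> \<le> c"
    using g v unfolding difference_bound_def by blast
  then show ?thesis by (simp add: integral_difference_shift[OF cg f])
qed

text \<open>Replacing a test function by its average along a segment of length at most \<open>\<epsilon>\<close> changes its pairing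
with \<open>f\<close> by at most \<open>c\<close>.\<close>

lemma difference_bound_average:
  assumes f: "loc_integrable f" and g: "difference_bound \<epsilon> f c g" and v: "norm v \<le> \<epsilon>"
  shows "\<bar>(LINT x|lborel. segment_average v g x * f x) - (LINT x|lborel. g x * f x)\<bar> \<le> c"
proof -
  from g obtain R where c: "continuous_on UNIV g" and R: "\<And>x. norm x > R \<Longrightarrow> g x = 0"
    by (auto simp: cont_comp_supp_def difference_bound_def)
  note swap = segment_average_integral_swap[OF c R f, where v = v]
  let ?F = "\<lambda>r. (LINT x|lborel. g (x + r *\<^sub>R v) * f x) - (LINT x|lborel. g x * f x)"
  have "(LINT x|lborel. segment_average v g x * f x) - (LINT x|lborel. g x * f x)
      = (LINT r|unit_uniform. ?F r)"
    using swap unit_uniform.prob_space by simp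
  moreover have "\<bar>LINT r|unit_uniform. ?F r\<bar> \<le> c"
  proof (rule unit_uniform_abs_integral_le)
    show "integrable unit_uniform ?F" using swap(2) by simp
    fix r :: real assume "r \<in> {0..1}"
    then have "norm (r *\<^sub>R v) \<le> \<epsilon>"
      using v mult_left_le_one_le[of "norm v" r] by simp
    then show "\<bar>?F r\<bar> \<le> c" by (rule difference_bound_shift[OF f g])
  qed
  ultimately show ?thesis by simp
qed

text \<open>Successive averages along the segments \<open>vs\<close>. For the vectors \<open>\<epsilon> e\<^sub>i\<close> this is the average over a cube
of side \<open>\<epsilon>\<close>.\<close>

abbreviation iterated_average :: "'a::euclidean_space list \<Rightarrow> ('a \<Rightarrow> real) \<Rightarrow> 'a \<Rightarrow> real" where
  "iterated_average \<equiv> foldr segment_average"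

lemma difference_bound_iterated_average:
  assumes f: "loc_integrable f" and g: "difference_bound \<epsilon> f c g"
  shows "difference_bound \<epsilon> f c (iterated_average vs g)"
  by (induction vs) (auto intro: difference_bound_segment_average[OF f] g)

lemma iterated_average_telescope:
  assumes f: "loc_integrable f" and g: "difference_bound \<epsilon> f c g"
    and vs: "\<And>v. v \<in> set vs \<Longrightarrow> norm v \<le> \<epsilon>"
  shows "\<bar>(LINT x|lborel. iterated_average vs g x * f x) - (LINT x|lborel. g x * f x)\<bar>
    \<le> real (length vs) * c"
  using vs
proof (induction vs)
  case (Cons v vs)
  have "\<bar>(LINT x|lborel. iterated_average (v # vs) g x * f x)
      - (LINT x|lborel. iterated_average vs g x * f x)\<bar> \<le> c"
    using difference_bound_average[OF f difference_bound_iterated_average[OF f g], of v vs]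
      Cons.prems by simp
  moreover have "\<bar>(LINT x|lborel. iterated_average vs g x * f x) - (LINT x|lborel. g x * f x)\<bar>
      \<le> real (length vs) * c"
    using Cons by simp
  ultimately show ?case by (simp add: algebra_simps)
qed simp

lemma continuous_on_iterated_average:
  "continuous_on UNIV g \<Longrightarrow> continuous_on UNIV (iterated_average vs g)"
  by (induction vs) (auto intro: continuous_on_segment_average)

lemma iterated_average_commute:
  assumes "continuous_on UNIV g"
  shows "segment_average v (iterated_average vs g) = iterated_average vs (segment_average v g)"
proof (induction vs)
  case (Cons w vs)
  have "segment_average v (segment_average w (iterated_average vs g))
      = segment_average w (segment_average v (iterated_average vs g))"
    by (rule ext, rule segment_average_commute) (rule continuous_on_iterated_average[OF assms])
  then show ?case using Cons by simp
qed simp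

lemma iterated_average_sum:
  assumes "\<And>i. i \<in> I \<Longrightarrow> continuous_on UNIV (g i)" "finite I"
  shows "iterated_average vs (\<lambda>y. \<Sum>i\<in>I. c * g i y) = (\<lambda>x. \<Sum>i\<in>I. c * iterated_average vs (g i) x)"
proof (induction vs)
  case (Cons v vs)
  have "segment_average v (\<lambda>x. \<Sum>i\<in>I. c * iterated_average vs (g i) x) x
      = (\<Sum>i\<in>I. c * segment_average v (iterated_average vs (g i)) x)" for x
    by (subst segment_average_sum)
      (auto intro!: continuous_intros continuous_on_iterated_average assms simp: segment_average_cmult)
  then show ?case using Cons by simp
qed simp

lemma iterated_average_difference:
  assumes "continuous_on UNIV g"
  shows "iterated_average vs (\<lambda>y. g (y + h) - g y)
    = (\<lambda>x. iterated_average vs g (x + h) - iterated_average vs g x)"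
proof (induction vs)
  case (Cons v vs)
  show ?case
    using segment_average_diff_shift[OF continuous_on_iterated_average[OF assms], of v vs h]
    by (simp add: Cons fun_eq_iff)
qed simp

text \<open>The divergence is replaced by its average over a cube of side \<open>\<epsilon>\<close>, at a cost of \<open>w\<close> for each of the
\<open>n\<close> coordinates. In the averaged divergence the \<open>i\<close>-th partial derivative becomes a difference
quotient with step \<open>\<epsilon>\<close> of an average of \<open>\<Phi>\<^sub>i\<close>; as \<open>\<Phi>\<^sub>i\<close> has norm at most \<open>\<epsilon>\<close>, its pairing with \<open>f\<close>
is at most \<open>(1/\<epsilon>) \<epsilon> w = w\<close>. Both contributions sum to \<open>2 n w\<close>.\<close>

lemma divergence_pairing_le:
  fixes f :: "real ^ 'n \<Rightarrow> real"
  assumes p: "1 \<le> p" and f: "loc_integrable f" and \<epsilon>: "0 < \<epsilon>" and w: "0 \<le> w"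
    and fw: "\<And>k. norm k \<le> \<epsilon> \<Longrightarrow> Lp_norm p (\<lambda>x. f (x - k) - f x) \<le> ereal w"
    and \<Phi>: "\<Phi> \<in> C0_infinity"
    and div1: "Lp_norm (dual_exponent p) (divergence \<Phi>) \<le> 1"
    and \<Phi>\<epsilon>: "Lp_norm (dual_exponent p) \<Phi> \<le> ereal \<epsilon>"
  shows "(LINT x|lborel. divergence \<Phi> x * f x) \<le> 2 * real CARD('n) * w"
proof -
  note q = dual_exponent_ge_1[OF p]
  from \<Phi> obtain R where s\<Phi>: "smooth_fun \<Phi>" and R: "\<And>x. norm x > R \<Longrightarrow> \<Phi> x = 0"
    by (auto simp: C0_infinity_iff)
  define v where "v i = \<epsilon> *\<^sub>R (axis i 1 :: real ^ 'n)" for i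
  have v: "norm (v i) = \<epsilon>" for i using \<epsilon> by (simp add: v_def norm_axis_1)
  define \<Psi> where "\<Psi> i x = \<Phi> x $ i" for i x
  define d where "d i x = frechet_derivative (\<Psi> i) (at x) (v i)" for i x
  have s\<Psi>: "smooth_fun (\<Psi> i)" for i unfolding \<Psi>_def by (rule smooth_fun_component[OF s\<Phi>])
  have c\<Psi>: "continuous_on UNIV (\<Psi> i)" for i using s\<Psi> by (rule smooth_fun_continuous)
  have cd: "continuous_on UNIV (d i)" for i
    unfolding d_def by (rule smooth_fun_continuous[OF smooth_fun_frechet_derivative[OF s\<Psi>]])
  have d_support: "d i x = 0" if x: "norm x > R" for i x
  proof -
    have "(\<Psi> i has_derivative (\<lambda>_. 0)) (at x)"
    proof (rule has_derivative_transform_within_open)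
      show "((\<lambda>_. 0) has_derivative (\<lambda>_. 0)) (at x)" by simp
      show "open {x :: real ^ 'n. R < norm x}" by (intro open_Collect_less continuous_intros)
    qed (use x R in \<open>auto simp: \<Psi>_def\<close>)
    then show ?thesis unfolding d_def using frechet_derivative_at by metis
  qed
  have div: "divergence \<Phi> = (\<lambda>x. \<Sum>i\<in>UNIV. (1 / \<epsilon>) * d i x)"
  proof
    fix x
    have "frechet_derivative (\<Psi> i) (at x) (axis i 1) = (1 / \<epsilon>) * d i x" for i
    proof -
      have "linear (frechet_derivative (\<Psi> i) (at x))"
        using smooth_fun_has_derivative[OF s\<Psi>] has_derivative_linear by blast
      then show ?thesis using \<epsilon> by (simp add: d_def v_def linear_cmul)
    qed
    then show "divergence \<Phi> x = (\<Sum>i\<in>UNIV. (1 / \<epsilon>) * d i x)"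
      by (simp add: divergence_eq[OF s\<Phi>] flip: \<Psi>_def)
  qed
  have cc_div: "cont_comp_supp (divergence \<Phi>)"
    unfolding cont_comp_supp_def div
    using d_support \<epsilon> by (auto intro!: continuous_intros cd exI[of _ R])
  have db_div: "difference_bound \<epsilon> f w (divergence \<Phi>)"
    using difference_bound_Holder[OF p f cc_div _ _ w fw, of 1] div1 by (simp add: one_ereal_def)
  have db_\<Psi>: "difference_bound \<epsilon> f (\<epsilon> * w) (\<Psi> i)" for i
  proof (rule difference_bound_Holder[OF p f _ _ \<epsilon> w fw])
    show "cont_comp_supp (\<Psi> i)"
      unfolding cont_comp_supp_def using c\<Psi>[of i] R by (auto simp: \<Psi>_def intro!: exI[of _ R])
    then have "(\<lambda>x. norm (\<Psi> i x)) \<in> borel_measurable lebesgue"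
      by (intro borel_measurable_lebesgueI measurable_compose[OF cont_comp_suppD(2) borel_measurable_norm])
    then have "Lp_norm (dual_exponent p) (\<Psi> i) \<le> Lp_norm (dual_exponent p) \<Phi>"
      by (rule Lp_norm_mono_AE[OF q]) (simp add: \<Psi>_def component_le_norm_cart)
    then show "Lp_norm (dual_exponent p) (\<Psi> i) \<le> ereal \<epsilon>" using \<Phi>\<epsilon> by (rule order_trans)
  qed
  obtain "is" :: "'n list" where "is": "set is = UNIV" "distinct is"
    using finite_distinct_list[of "UNIV :: 'n set"] by auto
  have len: "length is = CARD('n)" using "is" distinct_card[of "is"] by simp
  define vs where "vs = map v is"
  have term_bound: "\<bar>LINT x|lborel. iterated_average vs (d i) x * f x\<bar> \<le> \<epsilon> * w"
    and term_int: "integrable lborel (\<lambda>x. iterated_average vs (d i) x * f x)" for i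
  proof -
    \<comment> \<open>The average in direction \<open>i\<close> is pulled to the front, where it meets the derivative.\<close>
    obtain as bs where split: "is = as @ i # bs"
      using "is"(1) split_list[of i "is"] by auto
    define us where "us = map v as @ map v bs"
    define \<Theta> where "\<Theta> = iterated_average us (\<Psi> i)"
    have "segment_average (v i) (d i) = (\<lambda>x. \<Psi> i (x + v i) - \<Psi> i x)"
      unfolding d_def by (rule ext) (rule segment_average_frechet_derivative[OF s\<Psi>])
    then have "iterated_average vs (d i) = iterated_average us (\<lambda>x. \<Psi> i (x + v i) - \<Psi> i x)"
      by (simp add: vs_def us_def split iterated_average_commute[OF cd])
    then have eq: "iterated_average vs (d i) = (\<lambda>x. \<Theta> (x + v i) - \<Theta> x)"
      by (simp add: \<Theta>_def iterated_average_difference[OF c\<Psi>])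
    have db: "difference_bound \<epsilon> f (\<epsilon> * w) \<Theta>"
      unfolding \<Theta>_def by (rule difference_bound_iterated_average[OF f db_\<Psi>])
    then have cc: "cont_comp_supp \<Theta>" by (simp add: difference_bound_def)
    note int = cont_comp_supp_integrable[OF cc f]
      cont_comp_supp_integrable[OF cont_comp_supp_shift[OF cc, of "v i"] f]
    show "integrable lborel (\<lambda>x. iterated_average vs (d i) x * f x)"
      unfolding eq left_diff_distrib using int by simp
    show "\<bar>LINT x|lborel. iterated_average vs (d i) x * f x\<bar> \<le> \<epsilon> * w"
      using difference_bound_shift[OF f db, of "v i"] int by (simp add: eq left_diff_distrib v)
  qed
  have "\<bar>LINT x|lborel. iterated_average vs (divergence \<Phi>) x * f x\<bar>
      = \<bar>\<Sum>i\<in>UNIV. (1 / \<epsilon>) * (LINT x|lborel. iterated_average vs (d i) x * f x)\<bar>"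
    unfolding div iterated_average_sum[OF cd finite] sum_distrib_right mult.assoc
    by (subst Bochner_Integration.integral_sum) (use term_int in auto)
  also have "\<dots> \<le> (\<Sum>i\<in>(UNIV :: 'n set). (1 / \<epsilon>) * (\<epsilon> * w))"
    using \<epsilon> term_bound
    by (intro order_trans[OF sum_abs] sum_mono) (auto simp: abs_mult divide_le_eq mult.commute)
  also have "\<dots> = real CARD('n) * w" using \<epsilon> by simp
  finally have 1: "\<bar>LINT x|lborel. iterated_average vs (divergence \<Phi>) x * f x\<bar> \<le> real CARD('n) * w" .
  have "\<bar>(LINT x|lborel. iterated_average vs (divergence \<Phi>) x * f x)
      - (LINT x|lborel. divergence \<Phi> x * f x)\<bar> \<le> real (length vs) * w"
    by (rule iterated_average_telescope[OF f db_div]) (auto simp: vs_def v)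
  then show ?thesis using 1 len by (simp add: vs_def)
qed

section \<open>Passing to a Borel representative\<close>

lemma lebesgue_integral_borel_representative:
  fixes f f\<^sub>0 g :: "'a::euclidean_space \<Rightarrow> real"
  assumes f: "f \<in> borel_measurable lebesgue" and [measurable]: "f\<^sub>0 \<in> borel_measurable borel"
    and AE: "AE x in lborel. f x = f\<^sub>0 x" and [measurable]: "g \<in> borel_measurable borel"
  shows "(LINT x|lebesgue. g x * f x) = (LINT x|lborel. g x * f\<^sub>0 x)"
proof -
  have "(LINT x|lebesgue. g x * f x) = (LINT x|lebesgue. g x * f\<^sub>0 x)"
  proof (rule integral_cong_AE)
    show "(\<lambda>x. g x * f x) \<in> borel_measurable lebesgue"
      by (intro borel_measurable_times f borel_measurable_lebesgueI) auto
    show "(\<lambda>x. g x * f\<^sub>0 x) \<in> borel_measurable lebesgue"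
      by (intro borel_measurable_lebesgueI) auto
    show "AE x in lebesgue. g x * f x = g x * f\<^sub>0 x"
      using AE by (simp add: AE_completion_iff eventually_mono)
  qed
  also have "\<dots> = (LINT x|lborel. g x * f\<^sub>0 x)"
    by (rule integral_completion) measurable
  finally show ?thesis .
qed

lemma AE_lborel_shiftI:
  fixes P :: "'a::euclidean_space \<Rightarrow> bool"
  assumes "AE x in lborel. P x"
  shows "AE x in lborel. P (x + h)"
proof -
  obtain N where N: "N \<in> null_sets lborel" "{x. \<not> P x} \<subseteq> N"
    using assms by (auto simp: eventually_ae_filter)
  have "AE x in lborel. x \<notin> N" using N(1) by (rule AE_not_in)
  moreover have "{x. x \<notin> N} \<in> sets borel"
  proof -
    have "N \<in> sets borel" using N(1) by (simp add: null_sets_def)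
    then have "- N \<in> sets borel" by (rule borel_comp)
    then show ?thesis by (simp add: Compl_eq)
  qed
  ultimately have "AE x in lborel. x + h \<notin> N" by (simp add: AE_lborel_shift[of "\<lambda>x. x \<notin> N"])
  then show ?thesis by eventually_elim (use N(2) in auto)
qed

lemma Lp_norm_difference_borel_representative:
  fixes f f\<^sub>0 :: "'a::euclidean_space \<Rightarrow> real"
  assumes p: "1 \<le> p" and [measurable]: "f\<^sub>0 \<in> borel_measurable borel"
    and AE: "AE x in lborel. f x = f\<^sub>0 x"
  shows "Lp_norm p (\<lambda>x. f (x - h) - f x) = Lp_norm p (\<lambda>x. f\<^sub>0 (x - h) - f\<^sub>0 x)"
proof -
  have "AE x in lborel. f (x - h) = f\<^sub>0 (x - h)"
    using AE_lborel_shiftI[OF AE, of "- h"] by simp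
  with AE have eq: "AE x in lborel. norm (f (x - h) - f x) = norm (f\<^sub>0 (x - h) - f\<^sub>0 x)"
    by eventually_elim simp
  have m: "(\<lambda>x. norm (f\<^sub>0 (x - h) - f\<^sub>0 x)) \<in> borel_measurable lebesgue"
    by (rule borel_measurable_lebesgueI) measurable
  have "AE x in lebesgue. norm (f\<^sub>0 (x - h) - f\<^sub>0 x) = norm (f (x - h) - f x)"
    using eq by (simp add: AE_completion_iff eq_commute)
  then have "(\<lambda>x. norm (f (x - h) - f x)) \<in> borel_measurable lebesgue"
    by (rule borel_measurable_AE[OF m])
  from Lp_norm_cong_AE[OF p this m eq] show ?thesis .
qed

section \<open>Comparison of the moduli\<close>

text \<open>A pair \<open>(e, \<phi>)\<close> yields the vector field \<open>\<phi> e\<close>, which has divergence \<open>\<partial>\<^sub>e \<phi>\<close> and pointwise norm \<open>|\<phi>|\<close>.\<close>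

lemma sigma_tilde_modulus_le_sigma_modulus:
  fixes f :: "real ^ 'n \<Rightarrow> real"
  shows "sigma_tilde_modulus p f \<epsilon> \<le> sigma_modulus p f \<epsilon>"
  unfolding sigma_tilde_modulus_def
proof (rule Sup_least, clarify)
  fix e :: "real ^ 'n" and \<phi> :: "real ^ 'n \<Rightarrow> real"
  assume e: "norm e = 1" and \<phi>: "\<phi> \<in> C0_infinity"
    and 1: "Lp_norm (dual_exponent p) (directional_derivative e \<phi>) \<le> 1"
    and 2: "Lp_norm (dual_exponent p) \<phi> \<le> ereal \<epsilon>"
  have s\<phi>: "smooth_fun \<phi>" using \<phi> by (simp add: C0_infinity_iff)
  define \<Phi> where "\<Phi> x = \<phi> x *\<^sub>R e" for x
  have s\<Phi>: "smooth_fun \<Phi>"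
    unfolding \<Phi>_def by (rule smooth_fun_linear_image[OF s\<phi> bounded_linear_scaleR_left])
  have \<Phi>: "\<Phi> \<in> C0_infinity"
    using \<phi> s\<Phi> by (auto simp: C0_infinity_iff \<Phi>_def)
  have "Lp_norm (dual_exponent p) \<Phi> = Lp_norm (dual_exponent p) \<phi>"
    by (simp add: Lp_norm_def \<Phi>_def e)
  moreover have div: "divergence \<Phi> = directional_derivative e \<phi>"
  proof
    fix x
    let ?D = "frechet_derivative \<phi> (at x)"
    have lin: "linear ?D"
      using smooth_fun_has_derivative[OF s\<phi>] has_derivative_linear by blast
    have "frechet_derivative (\<lambda>y. \<Phi> y $ i) (at x) w = ?D w * e $ i" for i w
    proof -
      have "((\<lambda>y. \<Phi> y $ i) has_derivative (\<lambda>w. ?D w * e $ i)) (at x)"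
        unfolding \<Phi>_def using smooth_fun_has_derivative[OF s\<phi>, of x]
        by (simp add: has_derivative_mult_left)
      then show ?thesis using frechet_derivative_at by metis
    qed
    then have "divergence \<Phi> x = (\<Sum>i\<in>UNIV. e $ i * ?D (axis i 1))"
      by (simp add: divergence_eq[OF s\<Phi>] mult.commute)
    also have "\<dots> = ?D (\<Sum>i\<in>UNIV. e $ i *\<^sub>R axis i 1)"
      by (simp add: linear_sum[OF lin] linear_cmul[OF lin])
    also have "(\<Sum>i\<in>UNIV. e $ i *\<^sub>R axis i 1) = e"
      using basis_expansion[of e] by (simp add: scalar_mult_eq_scaleR)
    finally show "divergence \<Phi> x = directional_derivative e \<phi> x"
      by (simp add: directional_derivative_eq[OF s\<phi>])
  qed
  ultimately show "ereal (LINT x|lebesgue. directional_derivative e \<phi> x * f x) \<le> sigma_modulus p f \<epsilon>"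
    unfolding sigma_modulus_def using \<Phi> 1 2
    by (intro Sup_upper) (auto intro!: exI[of _ \<Phi>])
qed

lemma smooth_fun_directional_derivative:
  fixes \<phi> :: "real ^ 'n \<Rightarrow> real"
  assumes "smooth_fun \<phi>"
  shows "smooth_fun (directional_derivative e \<phi>)"
proof -
  have "directional_derivative e \<phi> = (\<lambda>x. frechet_derivative \<phi> (at x) e)"
    by (rule ext) (rule directional_derivative_eq[OF assms])
  then show ?thesis using smooth_fun_frechet_derivative[OF assms] by simp
qed

lemma half_omega_modulus_le_sigma_tilde_modulus:
  fixes f :: "real ^ 'n \<Rightarrow> real"
  assumes p: "1 \<le> p" and f: "f \<in> borel_measurable lebesgue"
    and f\<^sub>0: "loc_integrable f\<^sub>0" and AE: "AE x in lborel. f x = f\<^sub>0 x" and \<epsilon>: "0 < \<epsilon>"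
  shows "ereal (1 / 2) * omega_modulus p f (2 * \<epsilon>) \<le> sigma_tilde_modulus p f \<epsilon>"
proof -
  have [measurable]: "f\<^sub>0 \<in> borel_measurable borel" using f\<^sub>0 by (rule loc_integrable_measurable)
  have integral_le: "ereal (LINT x|lborel. directional_derivative e \<phi> x * f\<^sub>0 x) \<le> sigma_tilde_modulus p f \<epsilon>"
    if "norm e = 1" "\<phi> \<in> C0_infinity"
      "Lp_norm (dual_exponent p) (directional_derivative e \<phi>) \<le> 1"
      "Lp_norm (dual_exponent p) \<phi> \<le> ereal \<epsilon>" for e \<phi>
  proof -
    have "directional_derivative e \<phi> \<in> borel_measurable borel"
      using that(2) smooth_fun_directional_derivative[of \<phi> e]
      by (intro borel_measurable_continuous_onI smooth_fun_continuous) (simp add: C0_infinity_iff)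
    from lebesgue_integral_borel_representative[OF f _ AE this] that show ?thesis
      unfolding sigma_tilde_modulus_def
      by (intro Sup_upper) (auto intro!: exI[of _ e] exI[of _ \<phi>])
  qed
  have nonneg: "0 \<le> sigma_tilde_modulus p f \<epsilon>"
  proof -
    have z: "Lp_norm (dual_exponent p) (\<lambda>x::real ^ 'n. 0::real) \<le> ereal c" if "0 \<le> c" for c
      using dual_exponent_ge_1[OF p]
    proof (cases rule: exponent_cases)
      case 1
      then show ?thesis using that by (simp add: Lp_norm_infinity_le_iff_borel)
    next
      case (2 r)
      then show ?thesis using that by (simp add: Lp_norm_le_iff)
    qed
    \<comment> \<open>The zero function is admissible; any unit vector serves as direction.\<close>
    have d: "directional_derivative (axis undefined 1) (\<lambda>x. 0) = (\<lambda>x::real ^ 'n. 0)"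
      by (simp add: directional_derivative_def fun_eq_iff)
    have "(\<lambda>x::real ^ 'n. 0::real) \<in> C0_infinity"
      by (simp add: C0_infinity_iff smooth_fun_const)
    from integral_le[OF _ this, of "axis undefined 1"] show ?thesis
      using z[of 1] z[of \<epsilon>] \<epsilon> by (simp add: d norm_axis_1 one_ereal_def zero_ereal_def)
  qed
  show ?thesis
  proof (cases "sigma_tilde_modulus p f \<epsilon>")
    case (real b)
    have b: "0 \<le> b" using nonneg real by simp
    have "omega_modulus p f (2 * \<epsilon>) \<le> ereal (2 * b)"
      unfolding omega_modulus_def
    proof (rule SUP_least)
      fix h :: "real ^ 'n" assume "h \<in> {h. norm h \<le> 2 * \<epsilon>}"
      then have "Lp_norm p (\<lambda>x. f\<^sub>0 (x - h) - f\<^sub>0 x) \<le> ereal (2 * b)"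
        using integral_le real by (intro Lp_norm_difference_le_by_directional_derivatives[OF p f\<^sub>0 b]) auto
      then show "Lp_norm p (\<lambda>x. f (x - h) - f x) \<le> ereal (2 * b)"
        by (subst Lp_norm_difference_borel_representative[OF p _ AE]) auto
    qed
    then have "ereal (1 / 2) * omega_modulus p f (2 * \<epsilon>) \<le> ereal (1 / 2) * ereal (2 * b)"
      by (rule ereal_mult_left_mono) simp
    then show ?thesis using real by simp
  qed (use nonneg in auto)
qed

text \<open>For \<open>p = \<infinity>\<close> this uses that the essential supremum of the constant \<open>0\<close> is not negative, which holds
because Lebesgue measure is not zero.\<close>

lemma omega_modulus_nonneg:
  fixes f :: "real ^ 'n \<Rightarrow> real"
  assumes p: "1 \<le> p" and \<epsilon>: "0 < \<epsilon>"
  shows "0 \<le> omega_modulus p f \<epsilon>"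
proof -
  have "0 \<le> Lp_norm p (\<lambda>x::real ^ 'n. 0::real)"
    using p
  proof (cases rule: exponent_cases)
    case 1
    show ?thesis
    proof (rule ccontr)
      assume "\<not> ?thesis"
      then have "Lp_norm p (\<lambda>x::real ^ 'n. 0::real) < 0" by simp
      then obtain c where c: "Lp_norm p (\<lambda>x::real ^ 'n. 0::real) < ereal c" "ereal c < 0"
        using ereal_dense2 by blast
      then have "AE x::real ^ 'n in lborel. \<bar>0::real\<bar> \<le> c"
        using less_imp_le[OF c(1)] 1
        by (subst Lp_norm_infinity_le_iff_borel[symmetric]) simp_all
      then have "\<bar>0::real\<bar> \<le> c"
        by (rule continuous_AE_bound[OF continuous_on_const])
      then show False using c(2) by simp
    qed
  qed (simp add: Lp_norm_def Let_def)
  also have "\<dots> = Lp_norm p (\<lambda>x. f (x - 0) - f x)" by simp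
  also have "\<dots> \<le> omega_modulus p f \<epsilon>"
    unfolding omega_modulus_def using \<epsilon> by (intro SUP_upper) simp
  finally show ?thesis .
qed

text \<open>The constant \<open>2 n\<close> is smaller than \<open>2 (1 + \<surd>n + n)\<close>: smoothing one coordinate at a time costs \<open>n\<close>
differences of length \<open>\<epsilon>\<close>, whereas smoothing over the whole cube at once would involve differences
along its diagonal.\<close>

lemma sigma_modulus_le_omega_modulus:
  fixes f :: "real ^ 'n \<Rightarrow> real"
  assumes p: "1 \<le> p" and f: "f \<in> borel_measurable lebesgue"
    and f\<^sub>0: "loc_integrable f\<^sub>0" and AE: "AE x in lborel. f x = f\<^sub>0 x" and \<epsilon>: "0 < \<epsilon>"
  shows "sigma_modulus p f \<epsilon> \<le> ereal (2 * real CARD('n)) * omega_modulus p f \<epsilon>"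
proof -
  have [measurable]: "f\<^sub>0 \<in> borel_measurable borel" using f\<^sub>0 by (rule loc_integrable_measurable)
  have le_omega: "Lp_norm p (\<lambda>x. f\<^sub>0 (x - k) - f\<^sub>0 x) \<le> omega_modulus p f \<epsilon>" if "norm k \<le> \<epsilon>" for k
    unfolding omega_modulus_def
    by (subst Lp_norm_difference_borel_representative[OF p _ AE, symmetric])
      (use that in \<open>auto intro: SUP_upper\<close>)
  note nonneg = omega_modulus_nonneg[OF p \<epsilon>, of f]
  show ?thesis
  proof (cases "omega_modulus p f \<epsilon>")
    case (real w)
    have w: "0 \<le> w" using nonneg real by simp
    show ?thesis
      unfolding sigma_modulus_def
    proof (rule Sup_least, clarify)
      fix \<Phi> :: "real ^ 'n \<Rightarrow> real ^ 'n"
      assume \<Phi>: "\<Phi> \<in> C0_infinity" "Lp_norm (dual_exponent p) (divergence \<Phi>) \<le> 1"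
        "Lp_norm (dual_exponent p) \<Phi> \<le> ereal \<epsilon>"
      have s\<Phi>: "smooth_fun \<Phi>" using \<Phi>(1) by (simp add: C0_infinity_iff)
      have "divergence \<Phi> \<in> borel_measurable borel"
      proof (rule borel_measurable_continuous_onI)
        show "continuous_on UNIV (divergence \<Phi>)"
          unfolding divergence_def[abs_def]
          by (intro continuous_on_sum smooth_fun_continuous smooth_fun_directional_derivative
              smooth_fun_component s\<Phi>)
      qed
      then have "(LINT x|lebesgue. divergence \<Phi> x * f x) = (LINT x|lborel. divergence \<Phi> x * f\<^sub>0 x)"
        by (intro lebesgue_integral_borel_representative[OF f _ AE]) auto
      also have "\<dots> \<le> 2 * real CARD('n) * w"
        using le_omega real by (intro divergence_pairing_le[OF p f\<^sub>0 \<epsilon> w _ \<Phi>]) auto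
      finally show "ereal (LINT x|lebesgue. divergence \<Phi> x * f x)
          \<le> ereal (2 * real CARD('n)) * omega_modulus p f \<epsilon>"
        using real by simp
    qed
  qed (use nonneg in auto)
qed

theorem theorem2p7:
  fixes p :: ereal and f :: "real ^ 'n \<Rightarrow> real" and \<epsilon> :: real
  assumes "1 \<le> p" and "f \<in> Lp_space p" and "0 < \<epsilon>"
  shows "ereal (1 / 2) * omega_modulus p f (2 * \<epsilon>) \<le> sigma_tilde_modulus p f \<epsilon>
    \<and> sigma_tilde_modulus p f \<epsilon> \<le> sigma_modulus p f \<epsilon>
    \<and> sigma_modulus p f \<epsilon>
        \<le> ereal (2 * (1 + sqrt (real CARD('n)) + real CARD('n))) * omega_modulus p f \<epsilon>"
proof -
  have f: "f \<in> borel_measurable lebesgue" "Lp_norm p f < \<infinity>"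
    using assms(2) by (auto simp: Lp_space_def)
  obtain f\<^sub>0 where f\<^sub>0: "f\<^sub>0 \<in> borel_measurable borel" and AE: "AE x in lborel. f x = f\<^sub>0 x"
    using completion_ex_borel_measurable_real[OF f(1)] by auto
  have "Lp_norm p f\<^sub>0 = Lp_norm p f"
  proof (rule Lp_norm_cong_AE[OF assms(1)])
    show "(\<lambda>x. norm (f\<^sub>0 x)) \<in> borel_measurable lebesgue"
      by (rule borel_measurable_lebesgueI[OF measurable_compose[OF f\<^sub>0 borel_measurable_norm]])
    show "(\<lambda>x. norm (f x)) \<in> borel_measurable lebesgue"
      by (rule measurable_compose[OF f(1) borel_measurable_norm])
    show "AE x in lborel. norm (f\<^sub>0 x) = norm (f x)" using AE by eventually_elim simp
  qed
  then have loc: "loc_integrable f\<^sub>0"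
    using f(2) by (intro Lp_norm_finite_imp_loc_integrable[OF assms(1) f\<^sub>0]) simp
  have le: "sigma_modulus p f \<epsilon> \<le> ereal (2 * real CARD('n)) * omega_modulus p f \<epsilon>"
    by (rule sigma_modulus_le_omega_modulus[OF assms(1) f(1) loc AE assms(3)])
  have half: "ereal (1 / 2) * omega_modulus p f (2 * \<epsilon>) \<le> sigma_tilde_modulus p f \<epsilon>"
    by (rule half_omega_modulus_le_sigma_tilde_modulus[OF assms(1) f(1) loc AE assms(3)])
  have "ereal (2 * real CARD('n)) * omega_modulus p f \<epsilon>
      \<le> ereal (2 * (1 + sqrt (real CARD('n)) + real CARD('n))) * omega_modulus p f \<epsilon>"
    by (rule ereal_mult_right_mono) (use omega_modulus_nonneg[OF assms(1,3)] in auto)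
  with le half show ?thesis
    using sigma_tilde_modulus_le_sigma_modulus[of p f \<epsilon>] by (blast intro: order_trans)
qed

end
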